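(* Let $\nu,s,t\ge1$ be fixed integers, let $\{d_n\}_n$ be a positive integer sequence tending to $\infty$, and, for every $n$, let $(n_1,\ldots,n_\nu)=(n_1(n),\ldots,n_\nu(n))$ be a partition of $d_n$. Let $\kappa:[0,1]\times[-\pi,\pi]\to\mathbb C^{s\times t}$ be measurable and let $\{A_n\}_n$ be a sequence of matrices with $A_n$ of size $d_ns\times d_nt$ and $\{A_n\}_n\sim_{\rm GLT}\kappa$. Then $$\Bigl\{\mathop{\rm blocktril}_{n_1,\ldots,n_\nu}^{s,t}(A_n)\Bigr\}_n\sim_{\rm GLT}\kappa.$$
   Context: Conventions. A sequence of matrices is a sequence $\{A_n\}_n$, where $n$ varies in some infinite subset of $\mathbb N$ and $A_n$ is a complex matrix whose two dimensions both tend to $\infty$ as $n\to\infty$. All measure-theoretic terminology refers to Lebesgue measure; a matrix-valued function is measurable (continuous a.e., in $L^1$, etc.) if all its components are. $\|\cdot\|$ is the operator norm induced by the Euclidean norm, $x\wedge y=\min(x,y)$, and $I_s$ is the $s\times s$ identity matrix. A partition of a positive integer $m$ is a vector of positive integers $(m_1,\ldots,m_\nu)$ with $m_1+\cdots+m_\nu=m$. Block Gauss--Seidel preconditioner. Let $A=[A_{ij}]_{i,j=1}^m\in\mathbb C^{ms\times mt}$ with blocks $A_{ij}\in\mathbb C^{s\times t}$ and let $(m_1,\ldots,m_\nu)$ be a partition of $m$. For $p,q=1,\ldots,\nu$ let $A^{(pq)}=[A_{ij}]$ with $i=m_1+\cdots+m_{p-1}+1,\ldots,m_1+\cdots+m_p$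 and $j=m_1+\cdots+m_{q-1}+1,\ldots,m_1+\cdots+m_q$ (a block of size $m_ps\times m_qt$). Then $\mathop{\rm blocktril}_{m_1,\ldots,m_\nu}^{s,t}(A)$ is the $ms\times mt$ block lower triangular matrix whose block in position $(p,q)$ is $A^{(pq)}$ if $q\le p$ and zero if $q>p$. Toeplitz and diagonal sampling matrices. For $f:[-\pi,\pi]\to\mathbb C^{s\times t}$ in $L^1([-\pi,\pi])$, let $f_k=\frac1{2\pi}\int_{-\pi}^{\pi}f(\theta)e^{-{\rm i}k\theta}\,d\theta\in\mathbb C^{s\times t}$, $k\in\mathbb Z$, and $T_m(f)=[f_{i-j}]_{i,j=1}^m\in\mathbb C^{ms\times mt}$. For $a:[0,1]\to\mathbb C^{s\times t}$, $D_m(a)$ is the $ms\times mt$ block diagonal matrix with diagonal blocks $a(i/m)$, $i=1,\ldots,m$. Approximating class of sequences (a.c.s.). Let $\{X_n\}_n$ be a sequence of matrices with $X_n$ of size $p_n\times q_n$, and for each $m$ let $\{B_{n,m}\}_n$ be a sequence of matrices with $B_{n,m}$ of size $p_n\times q_n$. Write $\{B_{n,m}\}_n\xrightarrow{\rm a.c.s.}\{X_n\}_n$ if for every $m$ there exists $n_m$ such that, for $n\ge n_m$, $X_n=B_{n,m}+R_{n,m}+N_{n,m}$ with ${\rm rank}(R_{n,m})\le c(m)(p_n\wedge q_n)$ and $\|N_{n,m}\|\le\omega(m)$, where $n_m,c(m),\omega(m)$ depend only on $m$ and $\lim_{m\to\infty}c(m)=\lim_{m\to\infty}\omega(m)=0$.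 GLT sequences. Let $\{X_n\}_n$ be a sequence of matrices with $X_n$ of size $d_ns\times d_nt$ for fixed positive integers $s,t$ and some positive integer sequence $d_n\to\infty$, and let $\kappa:[0,1]\times[-\pi,\pi]\to\mathbb C^{s\times t}$ be measurable. Then $\{X_n\}_n\sim_{\rm GLT}\kappa$ (i.e. $\{X_n\}_n$ is a generalized locally Toeplitz sequence with symbol $\kappa$) means that there exist functions $a_{i,m},f_{i,m}$, $i=1,\ldots,N_m$, such that: $a_{i,m}:[0,1]\to\mathbb C$ is continuous a.e. and $f_{i,m}:[-\pi,\pi]\to\mathbb C^{s\times t}$ is in $L^1([-\pi,\pi])$; $\sum_{i=1}^{N_m}a_{i,m}(x)f_{i,m}(\theta)\to\kappa(x,\theta)$ a.e. on $[0,1]\times[-\pi,\pi]$ as $m\to\infty$; and $\bigl\{\sum_{i=1}^{N_m}D_{d_n}(a_{i,m}I_s)T_{d_n}(f_{i,m})\bigr\}_n\xrightarrow{\rm a.c.s.}\{X_n\}_n$. *)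

theory Defs
  imports "HOL-Analysis.Analysis" "Jordan_Normal_Form.DL_Rank"
begin

section \<open>Sequences of matrices\<close>

text \<open>Matrices are those of \<^theory>\<open>Jordan_Normal_Form.Matrix\<close>, because their sizes vary with \<open>n\<close>.
  The index \<open>n\<close> ranges over an infinite set \<open>I\<close> of natural numbers, and limits in \<open>n\<close> are taken
  along \<open>I\<close>.\<close>

definition to_infinity_along :: "nat set \<Rightarrow> (nat \<Rightarrow> nat) \<Rightarrow> bool" where
  "to_infinity_along I d \<longleftrightarrow> filterlim d at_top (inf sequentially (principal I))"

definition matrix_sequence ::
    "nat set \<Rightarrow> (nat \<Rightarrow> nat) \<Rightarrow> (nat \<Rightarrow> nat) \<Rightarrow> (nat \<Rightarrow> complex Matrix.mat) \<Rightarrow> bool" where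
  "matrix_sequence I p q X \<longleftrightarrow>
     infinite I \<and> to_infinity_along I p \<and> to_infinity_along I q \<and>
     (\<forall>n\<in>I. X n \<in> carrier_mat (p n) (q n))"

definition matrix_sum ::
    "nat \<Rightarrow> nat \<Rightarrow> ('i \<Rightarrow> complex Matrix.mat) \<Rightarrow> 'i set \<Rightarrow> complex Matrix.mat" where
  "matrix_sum r c X S = Matrix.mat r c (\<lambda>(k, l). \<Sum>i\<in>S. X i $$ (k, l))"

definition euclidean_norm :: "complex Matrix.vec \<Rightarrow> real" where
  "euclidean_norm v = L2_set (\<lambda>i. cmod (vec_index v i)) {..<dim_vec v}"

text \<open>The supremum is over the closed unit ball, so that it is also taken over a nonempty set
  when there are no columns.\<close>

definition operator_norm :: "complex Matrix.mat \<Rightarrow> real" where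
  "operator_norm A =
     (SUP x\<in>{x \<in> carrier_vec (dim_col A). euclidean_norm x \<le> 1}. euclidean_norm (A *\<^sub>v x))"

text \<open>In \<^term>\<open>vec_space.rank r A\<close>, the parameter \<open>r\<close> is the dimension of the space that
  contains the columns of \<open>A\<close>.\<close>

definition acs ::
    "nat set \<Rightarrow> (nat \<Rightarrow> nat) \<Rightarrow> (nat \<Rightarrow> nat) \<Rightarrow> (nat \<Rightarrow> nat \<Rightarrow> complex Matrix.mat)
       \<Rightarrow> (nat \<Rightarrow> complex Matrix.mat) \<Rightarrow> bool" where
  "acs I p q B X \<longleftrightarrow>
     matrix_sequence I p q X \<and> (\<forall>m. matrix_sequence I p q (B m)) \<and>
     (\<exists>(n0 :: nat \<Rightarrow> nat) (c :: nat \<Rightarrow> real) (\<omega> :: nat \<Rightarrow> real).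
        c \<longlonglongrightarrow> 0 \<and> \<omega> \<longlonglongrightarrow> 0 \<and>
        (\<forall>m. \<forall>n\<in>I. n \<ge> n0 m \<longrightarrow>
          (\<exists>R\<in>carrier_mat (p n) (q n). \<exists>N\<in>carrier_mat (p n) (q n).
             X n = B m n + R + N \<and>
             real (vec_space.rank (p n) R) \<le> c m * real (min (p n) (q n)) \<and>
             operator_norm N \<le> \<omega> m)))"


section \<open>Block matrices\<close>

text \<open>\<open>block_matrix m s t B\<close> is the block matrix with \<open>m \<times> m\<close> blocks \<open>B i j\<close> of size
  \<open>s \<times> t\<close>, and \<open>block_of s t A i j\<close> is the block of \<open>A\<close> in position \<open>(i, j)\<close>. All indices
  start from 0.\<close>

definition block_matrix ::
    "nat \<Rightarrow> nat \<Rightarrow> nat \<Rightarrow> (nat \<Rightarrow> nat \<Rightarrow> complex Matrix.mat) \<Rightarrow> complex Matrix.mat" where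
  "block_matrix m s t B =
     Matrix.mat (m * s) (m * t) (\<lambda>(k, l). B (k div s) (l div t) $$ (k mod s, l mod t))"

definition block_of ::
    "nat \<Rightarrow> nat \<Rightarrow> complex Matrix.mat \<Rightarrow> nat \<Rightarrow> nat \<Rightarrow> complex Matrix.mat" where
  "block_of s t A i j = Matrix.mat s t (\<lambda>(k, l). A $$ (i * s + k, j * t + l))"

definition is_partition :: "nat \<Rightarrow> nat list \<Rightarrow> bool" where
  "is_partition m ms \<longleftrightarrow> (\<forall>x\<in>set ms. 0 < x) \<and> sum_list ms = m"

definition part_range :: "nat list \<Rightarrow> nat \<Rightarrow> nat set" where
  "part_range ms p = {sum_list (take p ms)..<sum_list (take (Suc p) ms)}"

definition blocktril ::
    "nat \<Rightarrow> nat \<Rightarrow> nat list \<Rightarrow> complex Matrix.mat \<Rightarrow> complex Matrix.mat" where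
  "blocktril s t ms A =
     block_matrix (sum_list ms) s t (\<lambda>i j.
       if \<exists>p q. q \<le> p \<and> p < length ms \<and> i \<in> part_range ms p \<and> j \<in> part_range ms q
       then block_of s t A i j else 0\<^sub>m s t)"

lemma part_range_unique:
  assumes "i \<in> part_range ms p" "i \<in> part_range ms p'"
  shows "p = p'"
proof -
  have mono: "sum_list (take a ms) \<le> sum_list (take b ms)" if "a \<le> b" for a b
  proof -
    have "take b ms = take a ms @ take (b - a) (drop a ms)"
      using that by (metis le_add_diff_inverse take_add)
    then show ?thesis by simp
  qed
  have "False" if "a < b" "i \<in> part_range ms a" "i \<in> part_range ms b" for a b
    using mono[of "Suc a" b] that by (auto simp: part_range_def)
  then show ?thesis using assms by (metis linorder_neqE_nat)
qed

text \<open>The block of \<^const>\<open>blocktril\<close> in position \<open>(p, q)\<close> with respect to the partition is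
  that of \<open>A\<close> if \<open>q \<le> p\<close> and zero otherwise.\<close>

lemma blocktril_index:
  assumes "p < length ms" "q < length ms" "i \<in> part_range ms p" "j \<in> part_range ms q"
    and "k < s" "l < t"
  shows "blocktril s t ms A $$ (i * s + k, j * t + l) =
           (if q \<le> p then A $$ (i * s + k, j * t + l) else 0)"
proof -
  have part_less: "i' < sum_list ms" if "i' \<in> part_range ms p'" for i' p'
  proof -
    have "sum_list ms = sum_list (take (Suc p') ms) + sum_list (drop (Suc p') ms)"
      by (metis append_take_drop_id sum_list_append)
    then show ?thesis using that by (auto simp: part_range_def)
  qed
  have less: "a * r + b < M * r" if "a < M" "b < r" for a b r M :: nat
  proof -
    have "a * r + b < Suc a * r" using that by simp
    also have "\<dots> \<le> M * r" using that by (intro mult_le_mono1) simp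
    finally show ?thesis .
  qed
  have "(\<exists>p' q'. q' \<le> p' \<and> p' < length ms \<and> i \<in> part_range ms p' \<and> j \<in> part_range ms q')
          \<longleftrightarrow> q \<le> p"
    using assms part_range_unique by metis
  then show ?thesis
    using assms less[OF part_less[OF assms(3)] assms(5)] less[OF part_less[OF assms(4)] assms(6)]
    by (simp add: blocktril_def block_matrix_def block_of_def)
qed


section \<open>Matrix-valued functions\<close>

definition matrix_measurable_on ::
    "'a::euclidean_space set \<Rightarrow> nat \<Rightarrow> nat \<Rightarrow> ('a \<Rightarrow> complex Matrix.mat) \<Rightarrow> bool" where
  "matrix_measurable_on \<Omega> s t F \<longleftrightarrow>
     (\<forall>x\<in>\<Omega>. F x \<in> carrier_mat s t) \<and>
     (\<forall>k<s. \<forall>l<t. (\<lambda>x. F x $$ (k, l)) \<in> borel_measurable (lebesgue_on \<Omega>))"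

definition matrix_L1_on ::
    "'a::euclidean_space set \<Rightarrow> nat \<Rightarrow> nat \<Rightarrow> ('a \<Rightarrow> complex Matrix.mat) \<Rightarrow> bool" where
  "matrix_L1_on \<Omega> s t F \<longleftrightarrow>
     (\<forall>x\<in>\<Omega>. F x \<in> carrier_mat s t) \<and>
     (\<forall>k<s. \<forall>l<t. integrable (lebesgue_on \<Omega>) (\<lambda>x. F x $$ (k, l)))"

definition fourier_coeff ::
    "nat \<Rightarrow> nat \<Rightarrow> (real \<Rightarrow> complex Matrix.mat) \<Rightarrow> int \<Rightarrow> complex Matrix.mat" where
  "fourier_coeff s t f k =
     Matrix.mat s t (\<lambda>(u, v). 1 / (2 * complex_of_real pi) *
       (LINT \<theta>|lebesgue_on {-pi..pi}. f \<theta> $$ (u, v) * exp (- \<i> * of_int k * of_real \<theta>)))"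

definition toeplitz_matrix ::
    "nat \<Rightarrow> nat \<Rightarrow> nat \<Rightarrow> (real \<Rightarrow> complex Matrix.mat) \<Rightarrow> complex Matrix.mat" where
  "toeplitz_matrix m s t f = block_matrix m s t (\<lambda>i j. fourier_coeff s t f (int i - int j))"

text \<open>The sampling points are \<open>1/m, 2/m, \<dots>, 1\<close>; the shift by one is due to the indices
  starting from 0.\<close>

definition diagonal_sampling_matrix ::
    "nat \<Rightarrow> nat \<Rightarrow> nat \<Rightarrow> (real \<Rightarrow> complex Matrix.mat) \<Rightarrow> complex Matrix.mat" where
  "diagonal_sampling_matrix m s t a =
     block_matrix m s t (\<lambda>i j. if i = j then a (real (i + 1) / real m) else 0\<^sub>m s t)"


section \<open>GLT sequences\<close>

text \<open>The functions \<open>a\<^bsub>i,m\<^esub>\<close> and \<open>f\<^bsub>i,m\<^esub>\<close> are \<open>a m i\<close> and \<open>f m i\<close>.\<close>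

definition GLT ::
    "nat set \<Rightarrow> nat \<Rightarrow> nat \<Rightarrow> (nat \<Rightarrow> nat) \<Rightarrow> (nat \<Rightarrow> complex Matrix.mat)
       \<Rightarrow> (real \<times> real \<Rightarrow> complex Matrix.mat) \<Rightarrow> bool" where
  "GLT I s t d X \<kappa> \<longleftrightarrow>
     0 < s \<and> 0 < t \<and> (\<forall>n\<in>I. 0 < d n) \<and> to_infinity_along I d \<and>
     matrix_sequence I (\<lambda>n. d n * s) (\<lambda>n. d n * t) X \<and>
     matrix_measurable_on ({0..1} \<times> {-pi..pi}) s t \<kappa> \<and>
     (\<exists>(N :: nat \<Rightarrow> nat) (a :: nat \<Rightarrow> nat \<Rightarrow> real \<Rightarrow> complex)
        (f :: nat \<Rightarrow> nat \<Rightarrow> real \<Rightarrow> complex Matrix.mat).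
        (\<forall>m. \<forall>i\<in>{1..N m}.
           (AE x in lebesgue_on {0..1}. continuous (at x within {0..1}) (a m i)) \<and>
           matrix_L1_on {-pi..pi} s t (f m i)) \<and>
        (AE (x, \<theta>) in lebesgue_on ({0..1} \<times> {-pi..pi}). \<forall>k<s. \<forall>l<t.
           (\<lambda>m. matrix_sum s t (\<lambda>i. a m i x \<cdot>\<^sub>m f m i \<theta>) {1..N m} $$ (k, l))
             \<longlonglongrightarrow> \<kappa> (x, \<theta>) $$ (k, l)) \<and>
        acs I (\<lambda>n. d n * s) (\<lambda>n. d n * t)
          (\<lambda>m n. matrix_sum (d n * s) (d n * t)
             (\<lambda>i. diagonal_sampling_matrix (d n) s s (\<lambda>x. a m i x \<cdot>\<^sub>m 1\<^sub>m s) *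
                  toeplitz_matrix (d n) s t (f m i)) {1..N m})
          X)"

end

theory Submission
  imports Defs
begin

text \<open>The block triangular truncation is linear: it is a sum of \<open>\<nu>\<close> products \<open>P X Q\<close> with coordinate
  projections \<open>P\<close> and \<open>Q\<close>. Hence it multiplies ranks and norms of the perturbations in the a.c.s. by at
  most \<open>\<nu>\<close>, and it suffices that for fixed \<open>a\<close> and \<open>f\<close> the discarded part of \<open>D(a) T(f)\<close> is the sum of
  a matrix of rank at most \<open>\<epsilon> d\<close> and a matrix of norm at most \<open>\<epsilon>\<close> as soon as \<open>d\<close> is large. The unbounded
  values of \<open>a\<close> only affect few rows. The discarded part of \<open>T(f)\<close> consists of \<open>\<nu>\<close> corner blocks, which
  are treated entrywise by splitting \<open>f\<close> into a bounded function, for which the tail of the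
  square-summable Fourier coefficients makes the Frobenius norm of the corner \<open>o(\<surd>d)\<close>, and a
  function of small \<open>L\<^sup>1\<close> norm, whose whole Toeplitz matrix has trace norm small compared to \<open>d\<close>. In both cases
  an orthonormal basis of few large directions is split off.\<close>


section \<open>Low rank plus small norm\<close>

text \<open>The truncated sequence is compared with the very sums of \<open>D(a) T(f)\<close> that
  approximate \<open>A\<close>, not with their truncations, so the a.e. convergence of the symbols
  carries over unchanged; the price is that the discarded part of each sum has to be negligible. The
  positions of the cuts are arbitrary functions of \<open>n\<close>, so every estimate has to be
  uniform in them; only their number is fixed. For \<open>f\<close> merely in L^1 no single estimate
  works: its Fourier coefficients need not be square summable, and a small L^1 norm does not make
  the operator norm of the Toeplitz matrix small. But rank is measured relative to the size, so it
  is enough that a squared Frobenius norm or a trace norm is small compared to \<open>d\<close>: by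
  Markov's inequality few singular values then exceed a given level. Singular values themselves do
  not appear; a maximal orthonormal family takes their place.\<close>

text \<open>Matrices and vectors are functions on the natural numbers here; only the entries with indices below
  the explicitly given sizes matter. Rank bounds are expressed by sums of products, norm bounds
  by the bilinear form (without conjugation).\<close>

definition vnorm :: "nat \<Rightarrow> (nat \<Rightarrow> complex) \<Rightarrow> real" where
  "vnorm n x = L2_set (\<lambda>i. cmod (x i)) {..<n}"

definition bilin :: "nat \<Rightarrow> nat \<Rightarrow> (nat \<Rightarrow> nat \<Rightarrow> complex) \<Rightarrow> (nat \<Rightarrow> complex) \<Rightarrow> (nat \<Rightarrow> complex) \<Rightarrow> complex" where
  "bilin p q M y x = (\<Sum>i<p. \<Sum>j<q. y i * M i j * x j)"

definition norm_bound :: "nat \<Rightarrow> nat \<Rightarrow> (nat \<Rightarrow> nat \<Rightarrow> complex) \<Rightarrow> real \<Rightarrow> bool" where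
  "norm_bound p q M w \<longleftrightarrow> 0 \<le> w \<and> (\<forall>y x. cmod (bilin p q M y x) \<le> w * (vnorm p y * vnorm q x))"

text \<open>The bound is real, so that fractions of a dimension are added and compared without
  rounding.\<close>

definition rank_bound :: "nat \<Rightarrow> nat \<Rightarrow> (nat \<Rightarrow> nat \<Rightarrow> complex) \<Rightarrow> real \<Rightarrow> bool" where
  "rank_bound p q M r \<longleftrightarrow>
     (\<exists>k u v. real k \<le> r \<and> (\<forall>i<p. \<forall>j<q. M i j = (\<Sum>l<k. u l i * v l j)))"

text \<open>The shape of the error terms of an approximating class of sequences: \<open>M\<close> is
  negligible when \<open>r\<close> is small relative to the size and \<open>w\<close> is
  small.\<close>

definition splits :: "nat \<Rightarrow> nat \<Rightarrow> (nat \<Rightarrow> nat \<Rightarrow> complex) \<Rightarrow> real \<Rightarrow> real \<Rightarrow> bool" where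
  "splits p q M r w \<longleftrightarrow>
     (\<exists>R N. (\<forall>i<p. \<forall>j<q. M i j = R i j + N i j) \<and> rank_bound p q R r \<and> norm_bound p q N w)"

section \<open>Rank and norm bounds under sums\<close>

lemma vnorm_nonneg [simp]: "0 \<le> vnorm n x"
  by (simp add: vnorm_def)

lemma vnorm_square: "(vnorm n x)\<^sup>2 = (\<Sum>i<n. (cmod (x i))\<^sup>2)"
  by (simp add: vnorm_def L2_set_def sum_nonneg)

lemma vnorm_scale: "vnorm n (\<lambda>i. c * x i) = cmod c * vnorm n x"
  by (simp add: vnorm_def norm_mult L2_set_right_distrib)

lemma vnorm_eq_0: "vnorm n x = 0 \<longleftrightarrow> (\<forall>i<n. x i = 0)"
  by (auto simp: vnorm_def L2_set_eq_0_iff)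

lemma vnorm_cnj [simp]: "vnorm n (\<lambda>i. cnj (x i)) = vnorm n x"
  by (simp add: vnorm_def)

lemma cauchy_schwarz: "cmod (\<Sum>i<n. y i * x i) \<le> vnorm n y * vnorm n x"
proof -
  have "cmod (\<Sum>i<n. y i * x i) \<le> (\<Sum>i<n. \<bar>cmod (y i)\<bar> * \<bar>cmod (x i)\<bar>)"
    by (rule sum_norm_le) (simp add: norm_mult)
  also have "\<dots> \<le> vnorm n y * vnorm n x"
    unfolding vnorm_def by (rule L2_set_mult_ineq)
  finally show ?thesis .
qed

lemma norm_boundI:
  assumes "0 \<le> w" "\<And>y x. cmod (bilin p q M y x) \<le> w * (vnorm p y * vnorm q x)"
  shows "norm_bound p q M w"
  using assms by (simp add: norm_bound_def)

lemma rank_boundI: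
  assumes "real k \<le> r" "\<And>i j. i < p \<Longrightarrow> j < q \<Longrightarrow> M i j = (\<Sum>l<k. u l i * v l j)"
  shows "rank_bound p q M r"
  using assms unfolding rank_bound_def by blast

lemma bilin_add: "bilin p q (\<lambda>i j. M i j + N i j) y x = bilin p q M y x + bilin p q N y x"
  by (simp add: bilin_def algebra_simps sum.distrib)

lemma norm_bound_mono:
  assumes "norm_bound p q M w" "w \<le> w'"
  shows "norm_bound p q M w'"
proof (rule norm_boundI)
  fix y x
  have "cmod (bilin p q M y x) \<le> w * (vnorm p y * vnorm q x)"
    using assms(1) by (simp add: norm_bound_def)
  also have "\<dots> \<le> w' * (vnorm p y * vnorm q x)"
    using assms(2) by (intro mult_right_mono) auto
  finally show "cmod (bilin p q M y x) \<le> w' * (vnorm p y * vnorm q x)" .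
qed (use assms in \<open>simp add: norm_bound_def\<close>)

lemma rank_bound_mono: "rank_bound p q M r \<Longrightarrow> r \<le> r' \<Longrightarrow> rank_bound p q M r'"
  unfolding rank_bound_def by (elim exE conjE, intro exI conjI) (rule order_trans)

lemma norm_bound_add:
  assumes "norm_bound p q M v" "norm_bound p q N w"
  shows "norm_bound p q (\<lambda>i j. M i j + N i j) (v + w)"
proof (rule norm_boundI)
  show "0 \<le> v + w" using assms by (simp add: norm_bound_def)
  fix y x
  have "cmod (bilin p q M y x + bilin p q N y x)
      \<le> cmod (bilin p q M y x) + cmod (bilin p q N y x)" by (rule norm_triangle_ineq)
  also have "\<dots> \<le> v * (vnorm p y * vnorm q x) + w * (vnorm p y * vnorm q x)"
    using assms by (intro add_mono) (auto simp: norm_bound_def)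
  finally show "cmod (bilin p q (\<lambda>i j. M i j + N i j) y x) \<le> (v + w) * (vnorm p y * vnorm q x)"
    by (simp add: bilin_add algebra_simps)
qed

lemma rank_bound_add:
  assumes "rank_bound p q M r" "rank_bound p q N s"
  shows "rank_bound p q (\<lambda>i j. M i j + N i j) (r + s)"
proof -
  obtain k u v where 1: "real k \<le> r" "\<And>i j. i < p \<Longrightarrow> j < q \<Longrightarrow> M i j = (\<Sum>l<k. u l i * v l j)"
    using assms(1) unfolding rank_bound_def by blast
  obtain k' u' v' where 2: "real k' \<le> s"
    "\<And>i j. i < p \<Longrightarrow> j < q \<Longrightarrow> N i j = (\<Sum>l<k'. u' l i * v' l j)"
    using assms(2) unfolding rank_bound_def by blast
  define U where "U l = (if l < k then u l else u' (l - k))" for l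
  define V where "V l = (if l < k then v l else v' (l - k))" for l
  have split: "(\<Sum>l<k + k'. f l) = (\<Sum>l<k. f l) + (\<Sum>l<k'. f (k + l))" for f :: "nat \<Rightarrow> complex"
    by (induction k') (auto simp: add.assoc)
  have "M i j + N i j = (\<Sum>l<k + k'. U l i * V l j)" if "i < p" "j < q" for i j
    unfolding split using 1(2) 2(2) that by (simp add: U_def V_def)
  moreover have "real (k + k') \<le> r + s" using 1(1) 2(1) by simp
  ultimately show ?thesis unfolding rank_bound_def by blast
qed

lemma norm_bound_zero: "0 \<le> w \<Longrightarrow> norm_bound p q (\<lambda>_ _. 0) w"
  by (simp add: norm_bound_def bilin_def)

lemma rank_bound_zero: "0 \<le> r \<Longrightarrow> rank_bound p q (\<lambda>_ _. 0) r"
  unfolding rank_bound_def by (intro exI[of _ 0]) auto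

lemma rank_bound_sum:
  assumes "finite S" "\<And>a. a \<in> S \<Longrightarrow> rank_bound p q (M a) r"
  shows "rank_bound p q (\<lambda>i j. \<Sum>a\<in>S. M a i j) (real (card S) * r)"
  using assms
proof (induction S rule: finite_induct)
  case empty
  show ?case by (simp add: rank_bound_zero)
next
  case (insert a S)
  have "rank_bound p q (\<lambda>i j. M a i j + (\<Sum>a\<in>S. M a i j)) (r + real (card S) * r)"
    using insert by (intro rank_bound_add) auto
  then show ?case using insert by (simp add: algebra_simps)
qed

lemma norm_bound_sum:
  assumes "finite S" "\<And>a. a \<in> S \<Longrightarrow> norm_bound p q (M a) r"
  shows "norm_bound p q (\<lambda>i j. \<Sum>a\<in>S. M a i j) (real (card S) * r)"
  using assms
proof (induction S rule: finite_induct)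
  case empty
  show ?case by (simp add: norm_bound_zero)
next
  case (insert a S)
  have "norm_bound p q (\<lambda>i j. M a i j + (\<Sum>a\<in>S. M a i j)) (r + real (card S) * r)"
    using insert by (intro norm_bound_add) auto
  then show ?case using insert by (simp add: algebra_simps)
qed

lemma splitsI:
  assumes "rank_bound p q R r" "norm_bound p q N w"
    "\<And>i j. i < p \<Longrightarrow> j < q \<Longrightarrow> M i j = R i j + N i j"
  shows "splits p q M r w"
  using assms unfolding splits_def by blast

lemma splitsE:
  assumes "splits p q M r w"
  obtains R N where "rank_bound p q R r" "norm_bound p q N w"
    "\<And>i j. i < p \<Longrightarrow> j < q \<Longrightarrow> M i j = R i j + N i j"
  using assms unfolding splits_def by blast

lemma splits_cong:
  assumes "splits p q M r w" "\<And>i j. i < p \<Longrightarrow> j < q \<Longrightarrow> N i j = M i j"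
  shows "splits p q N r w"
  using assms by (simp add: splits_def)

lemma splits_mono: "splits p q M r w \<Longrightarrow> r \<le> r' \<Longrightarrow> w \<le> w' \<Longrightarrow> splits p q M r' w'"
  unfolding splits_def using rank_bound_mono norm_bound_mono by blast

lemma splits_add:
  assumes "splits p q M r v" "splits p q N s w"
  shows "splits p q (\<lambda>i j. M i j + N i j) (r + s) (v + w)"
proof -
  obtain R1 N1 where 1: "rank_bound p q R1 r" "norm_bound p q N1 v"
    "\<And>i j. i < p \<Longrightarrow> j < q \<Longrightarrow> M i j = R1 i j + N1 i j" using splitsE[OF assms(1)] by blast
  obtain R2 N2 where 2: "rank_bound p q R2 s" "norm_bound p q N2 w"
    "\<And>i j. i < p \<Longrightarrow> j < q \<Longrightarrow> N i j = R2 i j + N2 i j" using splitsE[OF assms(2)] by blast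
  show ?thesis
    by (rule splitsI[OF rank_bound_add[OF 1(1) 2(1)] norm_bound_add[OF 1(2) 2(2)]])
      (simp add: 1(3) 2(3))
qed

lemma splits_sum:
  assumes "finite S" "\<And>a. a \<in> S \<Longrightarrow> splits p q (M a) r w"
  shows "splits p q (\<lambda>i j. \<Sum>a\<in>S. M a i j) (real (card S) * r) (real (card S) * w)"
  using assms
proof (induction S rule: finite_induct)
  case empty
  show ?case by (rule splitsI[OF rank_bound_zero norm_bound_zero]) auto
next
  case (insert a S)
  have "splits p q (\<lambda>i j. M a i j + (\<Sum>a\<in>S. M a i j)) (r + real (card S) * r) (w + real (card S) * w)"
    using insert by (intro splits_add) auto
  then show ?case using insert by (simp add: algebra_simps)
qed

section \<open>Restricting, reindexing and rescaling rows and columns\<close>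

lemma rank_bound_pullback:
  assumes "rank_bound p q M r"
    and "\<And>k. k < p' \<Longrightarrow> \<alpha> k \<noteq> 0 \<Longrightarrow> \<phi> k < p" "\<And>l. l < q' \<Longrightarrow> \<beta> l \<noteq> 0 \<Longrightarrow> \<psi> l < q"
  shows "rank_bound p' q' (\<lambda>k l. \<alpha> k * \<beta> l * M (\<phi> k) (\<psi> l)) r"
proof -
  obtain n u v where 1: "real n \<le> r" "\<And>i j. i < p \<Longrightarrow> j < q \<Longrightarrow> M i j = (\<Sum>a<n. u a i * v a j)"
    using assms(1) unfolding rank_bound_def by blast
  have "\<alpha> k * \<beta> l * M (\<phi> k) (\<psi> l) = (\<Sum>a<n. (\<alpha> k * u a (\<phi> k)) * (\<beta> l * v a (\<psi> l)))"
    if "k < p'" "l < q'" for k l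
  proof (cases "\<alpha> k = 0 \<or> \<beta> l = 0")
    case False
    then show ?thesis using 1(2) assms(2,3) that by (simp add: sum_distrib_left mult_ac)
  qed auto
  then show ?thesis using 1(1)
    by (intro rank_boundI[where k = "n" and u = "\<lambda>a k. \<alpha> k * u a (\<phi> k)" and v = "\<lambda>a l. \<beta> l * v a (\<psi> l)"]) auto
qed

text \<open>The transpose of the matrix with entry \<open>\<alpha> k\<close> in position
  \<open>(k, \<phi> k)\<close>, applied to \<open>y\<close>. A pullback of \<open>M\<close>
  multiplies \<open>M\<close> by such a matrix on the left and by the transpose of another on the
  right, so its form is that of \<open>M\<close> at pushed vectors.\<close>

definition push :: "nat \<Rightarrow> (nat \<Rightarrow> nat) \<Rightarrow> (nat \<Rightarrow> complex) \<Rightarrow> (nat \<Rightarrow> complex) \<Rightarrow> nat \<Rightarrow> complex" where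
  "push n \<phi> \<alpha> y i = (\<Sum>k | k < n \<and> \<alpha> k \<noteq> 0 \<and> \<phi> k = i. y k * \<alpha> k)"

lemma sum_push:
  assumes "\<And>k. k < p' \<Longrightarrow> \<alpha> k \<noteq> 0 \<Longrightarrow> \<phi> k < p"
  shows "(\<Sum>i<p. push p' \<phi> \<alpha> y i * F i) = (\<Sum>k<p'. y k * \<alpha> k * F (\<phi> k))"
proof -
  let ?S = "{k. k < p' \<and> \<alpha> k \<noteq> 0}"
  have "(\<Sum>i<p. push p' \<phi> \<alpha> y i * F i)
      = (\<Sum>i<p. \<Sum>k | k \<in> ?S \<and> \<phi> k = i. y k * \<alpha> k * F (\<phi> k))"
    unfolding push_def by (intro sum.cong) (auto simp: sum_distrib_right intro!: sum.cong)
  also have "\<dots> = (\<Sum>k\<in>?S. y k * \<alpha> k * F (\<phi> k))"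
    by (rule sum.group) (use assms in auto)
  also have "\<dots> = (\<Sum>k<p'. y k * \<alpha> k * F (\<phi> k))"
    by (rule sum.mono_neutral_left) auto
  finally show ?thesis .
qed

text \<open>Injectivity where the weight is nonzero leaves at most one index in each fibre, so
  nothing accumulates: entries are only moved and scaled.\<close>

lemma vnorm_push:
  assumes "\<And>k. k < p' \<Longrightarrow> \<alpha> k \<noteq> 0 \<Longrightarrow> \<phi> k < p" "inj_on \<phi> {k. k < p' \<and> \<alpha> k \<noteq> 0}"
    and "\<And>k. k < p' \<Longrightarrow> cmod (\<alpha> k) \<le> A" "0 \<le> A"
  shows "vnorm p (push p' \<phi> \<alpha> y) \<le> A * vnorm p' y"
proof -
  let ?S = "{k. k < p' \<and> \<alpha> k \<noteq> 0}"
  have push: "push p' \<phi> \<alpha> y (\<phi> k) = y k * \<alpha> k" if "k \<in> ?S" for k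
  proof -
    have "{k'. k' < p' \<and> \<alpha> k' \<noteq> 0 \<and> \<phi> k' = \<phi> k} = {k}"
      using that assms(2) by (auto simp: inj_on_def)
    then show ?thesis by (simp add: push_def)
  qed
  have "(vnorm p (push p' \<phi> \<alpha> y))\<^sup>2 = (\<Sum>i\<in>\<phi> ` ?S. (cmod (push p' \<phi> \<alpha> y i))\<^sup>2)"
    unfolding vnorm_square
  proof (rule sum.mono_neutral_right)
    show "\<forall>i\<in>{..<p} - \<phi> ` ?S. (cmod (push p' \<phi> \<alpha> y i))\<^sup>2 = 0"
    proof
      fix i assume "i \<in> {..<p} - \<phi> ` ?S"
      then have "{k. k < p' \<and> \<alpha> k \<noteq> 0 \<and> \<phi> k = i} = {}" by auto
      then show "(cmod (push p' \<phi> \<alpha> y i))\<^sup>2 = 0" unfolding push_def by (simp only: sum.empty) simp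
    qed
  qed (use assms(1) in auto)
  also have "\<dots> = (\<Sum>k\<in>?S. (cmod (push p' \<phi> \<alpha> y (\<phi> k)))\<^sup>2)"
    by (subst sum.reindex[OF assms(2)]) simp
  also have "\<dots> = (\<Sum>k\<in>?S. (cmod (y k * \<alpha> k))\<^sup>2)" by (intro sum.cong) (simp_all add: push)
  also have "\<dots> \<le> (\<Sum>k<p'. (cmod (y k * \<alpha> k))\<^sup>2)" by (intro sum_mono2) auto
  also have "\<dots> \<le> (\<Sum>k<p'. A\<^sup>2 * (cmod (y k))\<^sup>2)"
    by (intro sum_mono) (auto simp: norm_mult power_mult_distrib mult.commute
        intro!: mult_right_mono power_mono assms)
  also have "\<dots> = (A * vnorm p' y)\<^sup>2"
    by (simp add: power_mult_distrib vnorm_square sum_distrib_left)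
  finally show ?thesis by (rule power2_le_imp_le) (use assms(4) in simp)
qed

lemma bilin_push:
  assumes "\<And>k. k < p' \<Longrightarrow> \<alpha> k \<noteq> 0 \<Longrightarrow> \<phi> k < p" "\<And>l. l < q' \<Longrightarrow> \<beta> l \<noteq> 0 \<Longrightarrow> \<psi> l < q"
  shows "bilin p' q' (\<lambda>k l. \<alpha> k * \<beta> l * M (\<phi> k) (\<psi> l)) y x
       = bilin p q M (push p' \<phi> \<alpha> y) (push q' \<psi> \<beta> x)"
proof -
  have inner: "(\<Sum>j<q. push q' \<psi> \<beta> x j * M i j) = (\<Sum>l<q'. x l * \<beta> l * M i (\<psi> l))" for i
    by (rule sum_push) (rule assms(2))
  have "bilin p q M (push p' \<phi> \<alpha> y) (push q' \<psi> \<beta> x)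
      = (\<Sum>i<p. push p' \<phi> \<alpha> y i * (\<Sum>j<q. push q' \<psi> \<beta> x j * M i j))"
    by (simp add: bilin_def sum_distrib_left mult_ac)
  also have "\<dots> = (\<Sum>k<p'. y k * \<alpha> k * (\<Sum>l<q'. x l * \<beta> l * M (\<phi> k) (\<psi> l)))"
    unfolding inner by (rule sum_push) (rule assms(1))
  also have "\<dots> = bilin p' q' (\<lambda>k l. \<alpha> k * \<beta> l * M (\<phi> k) (\<psi> l)) y x"
    by (simp add: bilin_def sum_distrib_left mult_ac)
  finally show ?thesis ..
qed

lemma norm_bound_pullback:
  assumes "norm_bound p q M w"
    and "\<And>k. k < p' \<Longrightarrow> \<alpha> k \<noteq> 0 \<Longrightarrow> \<phi> k < p" "\<And>l. l < q' \<Longrightarrow> \<beta> l \<noteq> 0 \<Longrightarrow> \<psi> l < q"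
    and "inj_on \<phi> {k. k < p' \<and> \<alpha> k \<noteq> 0}" "inj_on \<psi> {l. l < q' \<and> \<beta> l \<noteq> 0}"
    and "\<And>k. k < p' \<Longrightarrow> cmod (\<alpha> k) \<le> A" "\<And>l. l < q' \<Longrightarrow> cmod (\<beta> l) \<le> 1" "0 \<le> A"
  shows "norm_bound p' q' (\<lambda>k l. \<alpha> k * \<beta> l * M (\<phi> k) (\<psi> l)) (w * A)"
proof (rule norm_boundI)
  have "0 \<le> w" using assms(1) by (simp add: norm_bound_def)
  then show "0 \<le> w * A" using assms(8) by simp
  fix y x
  have eq: "bilin p' q' (\<lambda>k l. \<alpha> k * \<beta> l * M (\<phi> k) (\<psi> l)) y x
      = bilin p q M (push p' \<phi> \<alpha> y) (push q' \<psi> \<beta> x)"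
    by (rule bilin_push) (rule assms(2,3); assumption)+
  have "cmod (bilin p q M (push p' \<phi> \<alpha> y) (push q' \<psi> \<beta> x))
      \<le> w * (vnorm p (push p' \<phi> \<alpha> y) * vnorm q (push q' \<psi> \<beta> x))"
    using assms(1) by (simp add: norm_bound_def)
  also have "\<dots> \<le> w * ((A * vnorm p' y) * (1 * vnorm q' x))"
    by (intro mult_left_mono mult_mono vnorm_push) (use assms \<open>0 \<le> w\<close> in auto)
  finally show "cmod (bilin p' q' (\<lambda>k l. \<alpha> k * \<beta> l * M (\<phi> k) (\<psi> l)) y x)
      \<le> w * A * (vnorm p' y * vnorm q' x)"
    unfolding eq by (simp only: mult_ac mult_1_left)
qed

text \<open>One operation covers three uses: cutting out a block (identity maps, 0/1 weights),
  multiplying rows by sampled values (the reason for a bound \<open>A\<close> on the row weights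
  only), and placing a scalar matrix at one entry of every block
  (\<open>\<phi> k = k div s\<close>).\<close>

lemma splits_pullback:
  assumes "splits p q M r w"
    and "\<And>k. k < p' \<Longrightarrow> \<alpha> k \<noteq> 0 \<Longrightarrow> \<phi> k < p" "\<And>l. l < q' \<Longrightarrow> \<beta> l \<noteq> 0 \<Longrightarrow> \<psi> l < q"
    and "inj_on \<phi> {k. k < p' \<and> \<alpha> k \<noteq> 0}" "inj_on \<psi> {l. l < q' \<and> \<beta> l \<noteq> 0}"
    and "\<And>k. k < p' \<Longrightarrow> cmod (\<alpha> k) \<le> A" "\<And>l. l < q' \<Longrightarrow> cmod (\<beta> l) \<le> 1" "0 \<le> A"
  shows "splits p' q' (\<lambda>k l. \<alpha> k * \<beta> l * M (\<phi> k) (\<psi> l)) r (w * A)"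
proof -
  obtain R N where 1: "rank_bound p q R r" "norm_bound p q N w"
    "\<And>i j. i < p \<Longrightarrow> j < q \<Longrightarrow> M i j = R i j + N i j" using splitsE[OF assms(1)] by blast
  have "\<alpha> k * \<beta> l * M (\<phi> k) (\<psi> l) = \<alpha> k * \<beta> l * R (\<phi> k) (\<psi> l) + \<alpha> k * \<beta> l * N (\<phi> k) (\<psi> l)"
    if "k < p'" "l < q'" for k l
    using 1(3) assms(2,3) that by (cases "\<alpha> k = 0 \<or> \<beta> l = 0") (auto simp: algebra_simps)
  then show ?thesis
    by (intro splitsI[OF rank_bound_pullback[OF 1(1)] norm_bound_pullback[OF 1(2)]])
      (use assms in auto)
qed

lemma rank_bound_rows:
  assumes "\<And>i j. i < p \<Longrightarrow> i \<notin> S \<Longrightarrow> j < q \<Longrightarrow> M i j = 0" "finite S"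
  shows "rank_bound p q M (real (card S))"
proof -
  obtain e where e: "bij_betw e {..<card S} S"
    using bij_betw_from_nat_into_finite[OF assms(2)] by blast
  have "M i j = (\<Sum>l<card S. (if e l = i then 1 else 0) * M (e l) j)" if "i < p" "j < q" for i j
  proof -
    have "(\<Sum>l<card S. (if e l = i then 1 else 0) * M (e l) j) = (\<Sum>a\<in>S. (if a = i then 1 else 0) * M a j)"
      by (rule sum.reindex_bij_betw[OF e])
    also have "\<dots> = M i j" using assms that by (auto simp: if_distrib[of "\<lambda>c. c * _"] cong: if_cong)
    finally show ?thesis ..
  qed
  then show ?thesis by (intro rank_boundI[OF order_refl])
qed

text \<open>By homogeneity both vectors may be scaled to length 1, where the two right-hand sides
  agree. The quadratic form is what the arithmetic-geometric mean inequality yields in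
  \<open>splits_form\<close>.\<close>

lemma norm_boundI_quadratic:
  assumes "0 \<le> w" "\<And>y x. cmod (bilin p q M y x) \<le> w * ((vnorm p y)\<^sup>2 + (vnorm q x)\<^sup>2) / 2"
  shows "norm_bound p q M w"
proof (rule norm_boundI)
  fix y x
  show "cmod (bilin p q M y x) \<le> w * (vnorm p y * vnorm q x)"
  proof (cases "vnorm p y = 0 \<or> vnorm q x = 0")
    case True
    then have "bilin p q M y x = 0" by (auto simp: bilin_def vnorm_eq_0)
    then show ?thesis using assms(1) by simp
  next
    case False
    let ?a = "vnorm p y" and ?b = "vnorm q x"
    have pos: "?a > 0" "?b > 0" using False vnorm_nonneg by (metis less_eq_real_def)+
    define y' x' where "y' = (\<lambda>i. complex_of_real (1 / ?a) * y i)" and "x' = (\<lambda>i. complex_of_real (1 / ?b) * x i)"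
    have "vnorm p y' = 1" "vnorm q x' = 1"
      unfolding y'_def x'_def vnorm_scale norm_of_real using pos by auto
    then have "cmod (bilin p q M y' x') \<le> w" using assms(2)[of y' x'] by simp
    moreover have "bilin p q M y' x' = complex_of_real (1 / (?a * ?b)) * bilin p q M y x"
      by (simp add: bilin_def y'_def x'_def sum_distrib_left mult_ac)
    ultimately have "(1 / (?a * ?b)) * cmod (bilin p q M y x) \<le> w"
      using pos by (simp add: norm_mult norm_divide)
    then show ?thesis using pos by (simp add: field_simps)
  qed
qed (rule assms)

section \<open>Orthonormal families and projections\<close>

definition orthonormal :: "nat \<Rightarrow> nat \<Rightarrow> (nat \<Rightarrow> nat \<Rightarrow> complex) \<Rightarrow> bool" where
  "orthonormal m k u \<longleftrightarrow>
     (\<forall>l<k. \<forall>l'<k. (\<Sum>j<m. u l j * cnj (u l' j)) = (if l = l' then 1 else 0))"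

text \<open>For an orthonormal family this is the projection onto the orthogonal complement of its
  span.\<close>

definition proj :: "nat \<Rightarrow> nat \<Rightarrow> (nat \<Rightarrow> nat \<Rightarrow> complex) \<Rightarrow> (nat \<Rightarrow> complex) \<Rightarrow> nat \<Rightarrow> complex" where
  "proj m k u x j = x j - (\<Sum>l<k. (\<Sum>b<m. x b * cnj (u l b)) * u l j)"

lemma proj_orthogonal:
  assumes "orthonormal m k u" "l < k"
  shows "(\<Sum>j<m. proj m k u x j * cnj (u l j)) = 0"
proof -
  have "(\<Sum>j<m. (\<Sum>l'<k. (\<Sum>b<m. x b * cnj (u l' b)) * u l' j) * cnj (u l j))
      = (\<Sum>l'<k. (\<Sum>b<m. x b * cnj (u l' b)) * (\<Sum>j<m. u l' j * cnj (u l j)))"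
    by (simp only: sum_distrib_right sum_distrib_left, subst sum.swap) (simp add: mult_ac)
  also have "\<dots> = (\<Sum>l'<k. (\<Sum>b<m. x b * cnj (u l' b)) * (if l' = l then 1 else 0))"
    using assms by (intro sum.cong) (auto simp: orthonormal_def)
  also have "\<dots> = (\<Sum>b<m. x b * cnj (u l b))"
    using assms(2) by (simp add: if_distrib cong: if_cong)
  finally show ?thesis by (simp add: proj_def left_diff_distrib sum_subtractf)
qed

lemma sum_mult_le_squares:
  "cmod (\<Sum>j<m. y j * x j) \<le> ((vnorm m y)\<^sup>2 + (vnorm m x)\<^sup>2) / 2"
proof -
  have "0 \<le> (vnorm m y - vnorm m x)\<^sup>2" by simp
  then have "vnorm m y * vnorm m x \<le> ((vnorm m y)\<^sup>2 + (vnorm m x)\<^sup>2) / 2"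
    by (simp add: power2_eq_square algebra_simps)
  with cauchy_schwarz show ?thesis by (rule order_trans)
qed

lemma of_real_vnorm_square: "complex_of_real ((vnorm m x)\<^sup>2) = (\<Sum>j<m. x j * cnj (x j))"
  by (simp only: vnorm_square of_real_sum complex_norm_square)

text \<open>The removed component is orthogonal to the projection \<open>?x\<close>, so the inner
  product of \<open>?x\<close> with \<open>x\<close> is the squared norm of \<open>?x\<close>; half
  of it is absorbed after the arithmetic-geometric mean inequality.\<close>

lemma vnorm_proj:
  assumes "orthonormal m k u"
  shows "vnorm m (proj m k u x) \<le> vnorm m x"
proof -
  let ?x = "proj m k u x"
  have "(\<Sum>j<m. ?x j * cnj (\<Sum>l<k. (\<Sum>b<m. x b * cnj (u l b)) * u l j))
      = (\<Sum>l<k. cnj (\<Sum>b<m. x b * cnj (u l b)) * (\<Sum>j<m. ?x j * cnj (u l j)))"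
    by (simp only: sum_distrib_left cnj_sum complex_cnj_mult, subst sum.swap) (simp add: mult_ac)
  also have "\<dots> = 0" using proj_orthogonal[OF assms] by simp
  finally have "(\<Sum>j<m. ?x j * cnj (\<Sum>l<k. (\<Sum>b<m. x b * cnj (u l b)) * u l j)) = 0" .
  moreover have "cnj (\<Sum>l<k. (\<Sum>b<m. x b * cnj (u l b)) * u l j) = cnj (x j) - cnj (?x j)" for j
    by (simp add: proj_def)
  ultimately have "(\<Sum>j<m. ?x j * cnj (x j)) - (\<Sum>j<m. ?x j * cnj (?x j)) = 0"
    unfolding sum_subtractf[symmetric] right_diff_distrib[symmetric] by simp
  then have "complex_of_real ((vnorm m ?x)\<^sup>2) = (\<Sum>j<m. ?x j * cnj (x j))"
    by (simp only: of_real_vnorm_square right_minus_eq)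
  then have "cmod (\<Sum>j<m. ?x j * cnj (x j)) = cmod (complex_of_real ((vnorm m ?x)\<^sup>2))"
    by (rule arg_cong[OF sym])
  then have "(vnorm m ?x)\<^sup>2 = cmod (\<Sum>j<m. ?x j * cnj (x j))"
    unfolding norm_of_real by simp
  also have "\<dots> \<le> ((vnorm m ?x)\<^sup>2 + (vnorm m x)\<^sup>2) / 2"
    using sum_mult_le_squares[where m = m and y = ?x and x = "\<lambda>j. cnj (x j)"] by simp
  finally have "(vnorm m ?x)\<^sup>2 \<le> (vnorm m x)\<^sup>2" by simp
  then show ?thesis by (rule power2_le_imp_le) simp
qed

text \<open>The proof is by duality: pair \<open>w\<close> with the combination of the \<open>u l\<close> whose
  coefficients are the conjugates of the coefficients of \<open>w\<close>.\<close>

lemma bessel: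
  assumes "orthonormal m k u"
  shows "(\<Sum>l<k. (cmod (\<Sum>j<m. w j * u l j))\<^sup>2) \<le> (vnorm m w)\<^sup>2"
proof -
  define c where "c l = (\<Sum>j<m. w j * u l j)" for l
  define z where "z j = (\<Sum>l<k. cnj (c l) * u l j)" for j
  let ?S = "\<Sum>l<k. (cmod (c l))\<^sup>2"
  have "z j * cnj (z j) = (\<Sum>l<k. \<Sum>l'<k. cnj (c l) * c l' * (u l j * cnj (u l' j)))" for j
    unfolding z_def cnj_sum sum_product by (intro sum.cong refl) (simp add: mult_ac)
  then have "(\<Sum>j<m. z j * cnj (z j))
      = (\<Sum>j<m. \<Sum>l<k. \<Sum>l'<k. cnj (c l) * c l' * (u l j * cnj (u l' j)))" by simp
  also have "\<dots> = (\<Sum>l<k. \<Sum>l'<k. cnj (c l) * c l' * (\<Sum>j<m. u l j * cnj (u l' j)))"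
    unfolding sum_distrib_left by (subst sum.swap, rule sum.cong[OF refl], rule sum.swap)
  also have "\<dots> = (\<Sum>l<k. \<Sum>l'<k. cnj (c l) * c l' * (if l = l' then 1 else 0))"
    using assms by (intro sum.cong) (auto simp: orthonormal_def)
  also have "\<dots> = (\<Sum>l<k. c l * cnj (c l))" by (simp add: if_distrib mult.commute cong: if_cong)
  also have "\<dots> = complex_of_real ?S" by (simp only: of_real_sum complex_norm_square)
  finally have "complex_of_real ((vnorm m z)\<^sup>2) = complex_of_real ?S"
    by (simp only: of_real_vnorm_square)
  then have z: "(vnorm m z)\<^sup>2 = ?S" by (simp only: of_real_eq_iff)
  have "(\<Sum>j<m. w j * z j) = (\<Sum>l<k. cnj (c l) * c l)"
  proof -
    have "(\<Sum>j<m. w j * z j) = (\<Sum>j<m. \<Sum>l<k. cnj (c l) * (w j * u l j))"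
      by (simp add: z_def sum_distrib_left mult_ac)
    also have "\<dots> = (\<Sum>l<k. \<Sum>j<m. cnj (c l) * (w j * u l j))" by (rule sum.swap)
    also have "\<dots> = (\<Sum>l<k. cnj (c l) * c l)"
      unfolding sum_distrib_left[symmetric] c_def[symmetric] ..
    finally show ?thesis .
  qed
  also have "\<dots> = complex_of_real ?S"
    unfolding of_real_sum complex_norm_square by (intro sum.cong refl mult.commute)
  finally have "cmod (\<Sum>j<m. w j * z j) = \<bar>?S\<bar>" by (simp only: norm_of_real)
  then have "?S = cmod (\<Sum>j<m. w j * z j)" by (simp add: sum_nonneg)
  also have "\<dots> \<le> ((vnorm m w)\<^sup>2 + ?S) / 2"
    using sum_mult_le_squares[where m = m and y = w and x = z] z by simp
  finally show ?thesis by (simp add: c_def)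
qed

text \<open>The \<open>u l\<close> form a maximal orthonormal family on which \<open>Q\<close> exceeds \<open>\<delta>\<close>.\<close>

lemma large_directions:
  fixes Q :: "(nat \<Rightarrow> complex) \<Rightarrow> real"
  assumes scale: "\<forall>c x. Q (\<lambda>j. c * x j) = (cmod c)\<^sup>2 * Q x"
    and zero: "\<forall>x. vnorm m x = 0 \<longrightarrow> Q x \<le> 0"
    and trace: "\<forall>k u. orthonormal m k u \<longrightarrow> (\<Sum>l<k. Q (u l)) \<le> C"
    and "0 < \<delta>"
  shows "\<exists>k u. orthonormal m k u \<and> real k \<le> C / \<delta> \<and>
    (\<forall>x. (\<forall>l<k. (\<Sum>j<m. x j * cnj (u l j)) = 0) \<longrightarrow> Q x \<le> \<delta> * (vnorm m x)\<^sup>2)"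
proof -
  define P where "P k \<longleftrightarrow> (\<exists>u. orthonormal m k u \<and> (\<forall>l<k. \<delta> < Q (u l)))" for k
  have P_le: "real k \<le> C / \<delta>" if Pk: "P k" for k
  proof -
    obtain u where u: "orthonormal m k u" "\<And>l. l < k \<Longrightarrow> \<delta> < Q (u l)"
      using Pk unfolding P_def by blast
    have "real k * \<delta> = (\<Sum>l<k. \<delta>)" by simp
    also have "\<dots> \<le> (\<Sum>l<k. Q (u l))" using u(2) by (intro sum_mono) (simp add: less_imp_le)
    also have "\<dots> \<le> C" using trace u(1) by blast
    finally show ?thesis using \<open>0 < \<delta>\<close> by (simp add: field_simps)
  qed
  \<comment> \<open>The trace bound caps the length of these families and the empty family is one,
    so a longest one exists.\<close>
  have "P 0" by (simp add: P_def orthonormal_def)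
  moreover have "k \<le> nat \<lceil>C / \<delta>\<rceil>" if "P k" for k using P_le[OF that] by linarith
  ultimately obtain k where k: "P k" "\<And>k'. P k' \<Longrightarrow> k' \<le> k"
    using GreatestI_nat[of P] Greatest_le_nat[of P] by blast
  obtain u where u: "orthonormal m k u" "\<And>l. l < k \<Longrightarrow> \<delta> < Q (u l)"
    using k(1) unfolding P_def by blast
  have "Q x \<le> \<delta> * (vnorm m x)\<^sup>2" if x: "\<And>l. l < k \<Longrightarrow> (\<Sum>j<m. x j * cnj (u l j)) = 0" for x
  proof (rule ccontr)
    assume large: "\<not> Q x \<le> \<delta> * (vnorm m x)\<^sup>2"
    then have "vnorm m x \<noteq> 0" using zero by fastforce
    then have pos: "vnorm m x > 0" using vnorm_nonneg by (metis less_eq_real_def)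
    \<comment> \<open>Normalised, the offending \<open>x\<close> is orthogonal to the family and
      extends it, against maximality.\<close>
    define e where "e = (\<lambda>j. complex_of_real (1 / vnorm m x) * x j)"
    have norm_e: "vnorm m e = 1" unfolding e_def vnorm_scale norm_of_real using pos by simp
    have e: "(\<Sum>j<m. e j * cnj (u l j)) = 0" if "l < k" for l
      using x[OF that] unfolding e_def mult.assoc sum_distrib_left[symmetric] by simp
    have e': "(\<Sum>j<m. u l j * cnj (e j)) = 0" if "l < k" for l
    proof -
      have "(\<Sum>j<m. u l j * cnj (e j)) = cnj (\<Sum>j<m. e j * cnj (u l j))" by (simp add: mult.commute)
      then show ?thesis using e[OF that] by simp
    qed
    have "(\<Sum>j<m. e j * cnj (e j)) = 1" using of_real_vnorm_square[of m e] norm_e by simp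
    then have "orthonormal m (Suc k) (u(k := e))"
      using u(1) e e' by (auto simp: orthonormal_def less_Suc_eq)
    moreover have "\<delta> < Q e"
      using large pos unfolding e_def scale[rule_format] norm_of_real
      by (simp add: field_simps power2_eq_square)
    then have "\<forall>l<Suc k. \<delta> < Q ((u(k := e)) l)" using u(2) by (auto simp: less_Suc_eq)
    ultimately have "P (Suc k)" unfolding P_def by blast
    then show False using k(2) by fastforce
  qed
  then show ?thesis using u(1) P_le[OF k(1)] by blast
qed

text \<open>The subtracted matrix is \<open>M U U*\<close>, with the \<open>u l\<close> as columns
  of \<open>U\<close>: a change of rank at most \<open>k\<close> amounts to projecting the right
  vector.\<close>

lemma bilin_proj_right:
  "bilin p q (\<lambda>i j. M i j - (\<Sum>l<k. (\<Sum>a<q. M i a * u l a) * cnj (u l j))) y x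
     = bilin p q M y (proj q k u x)"
proof -
  have "(\<Sum>j<q. (M i j - (\<Sum>l<k. (\<Sum>a<q. M i a * u l a) * cnj (u l j))) * x j)
      = (\<Sum>j<q. M i j * proj q k u x j)" for i
  proof -
    have "(\<Sum>j<q. (\<Sum>l<k. (\<Sum>a<q. M i a * u l a) * cnj (u l j)) * x j)
        = (\<Sum>l<k. (\<Sum>a<q. M i a * u l a) * (\<Sum>j<q. cnj (u l j) * x j))"
      unfolding sum_distrib_right[of _ _ "x _"] mult.assoc sum_distrib_left[of _ _ "{..<q}"]
      by (rule sum.swap)
    also have "\<dots> = (\<Sum>a<q. M i a * (\<Sum>l<k. (\<Sum>b<q. x b * cnj (u l b)) * u l a))"
      by (simp only: sum_distrib_right[of _ _ "sum _ _"] sum_distrib_left[of _ _ "{..<k}"], subst sum.swap)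
        (simp only: mult_ac)
    finally show ?thesis by (simp add: proj_def left_diff_distrib right_diff_distrib sum_subtractf)
  qed
  then show ?thesis by (simp add: bilin_def mult.assoc sum_distrib_left[symmetric])
qed

lemma bilin_transpose: "bilin p q M y x = bilin q p (\<lambda>i j. M j i) x y"
  unfolding bilin_def by (subst sum.swap) (simp add: mult_ac)

text \<open>The mirror image, for \<open>U U* M\<close>. Since the form does not conjugate its left
  vector, the projection acts on the conjugate of \<open>y\<close>.\<close>

lemma bilin_proj_left:
  "bilin p q (\<lambda>i j. M i j - (\<Sum>l<k. u l i * (\<Sum>a<p. cnj (u l a) * M a j))) y x
     = bilin p q M (\<lambda>i. cnj (proj p k u (\<lambda>a. cnj (y a)) i)) x"
proof -
  have "bilin p q (\<lambda>i j. M i j - (\<Sum>l<k. u l i * (\<Sum>a<p. cnj (u l a) * M a j))) y x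
      = bilin q p (\<lambda>i j. M j i - (\<Sum>l<k. (\<Sum>a<p. M a i * cnj (u l a)) * cnj (cnj (u l j)))) x y"
    by (subst bilin_transpose) (simp add: mult.commute)
  also have "\<dots> = bilin q p (\<lambda>i j. M j i) x (proj p k (\<lambda>l a. cnj (u l a)) y)"
    by (rule bilin_proj_right)
  also have "proj p k (\<lambda>l a. cnj (u l a)) y = (\<lambda>i. cnj (proj p k u (\<lambda>a. cnj (y a)) i))"
    by (rule ext) (simp add: proj_def)
  finally show ?thesis by (simp add: bilin_transpose[of q p])
qed

text \<open>Markov's inequality for squared singular values: \<open>Q x = |M x|^2\<close> sums to at
  most \<open>F\<close> over any orthonormal family, so at most \<open>F / \<delta>\<^sup>2\<close>
  members exceed \<open>\<delta>\<^sup>2\<close>. Projecting them away costs that much rank and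
  leaves norm at most \<delta>.\<close>

lemma splits_frobenius:
  assumes "(\<Sum>i<p. \<Sum>j<q. (cmod (M i j))\<^sup>2) \<le> F" "0 < \<delta>"
  shows "splits p q M (F / \<delta>\<^sup>2) \<delta>"
proof -
  define Q where "Q x = (vnorm p (\<lambda>i. \<Sum>j<q. M i j * x j))\<^sup>2" for x
  have scale: "Q (\<lambda>j. c * x j) = (cmod c)\<^sup>2 * Q x" for c x
  proof -
    have "(\<lambda>i. \<Sum>j<q. M i j * (c * x j)) = (\<lambda>i. c * (\<Sum>j<q. M i j * x j))"
      by (simp add: sum_distrib_left mult_ac)
    then show ?thesis by (simp add: Q_def vnorm_scale power_mult_distrib)
  qed
  have zero: "Q x \<le> 0" if "vnorm q x = 0" for x
    using that by (simp add: Q_def vnorm_eq_0)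
  have trace: "(\<Sum>l<k. Q (u l)) \<le> F" if "orthonormal q k u" for k u
  proof -
    have "(\<Sum>l<k. Q (u l)) = (\<Sum>i<p. \<Sum>l<k. (cmod (\<Sum>j<q. M i j * u l j))\<^sup>2)"
      unfolding Q_def vnorm_square by (rule sum.swap)
    \<comment> \<open>Bessel's inequality in every row of \<open>M\<close>.\<close>
    also have "\<dots> \<le> (\<Sum>i<p. (vnorm q (M i))\<^sup>2)" by (intro sum_mono bessel[OF that])
    also have "\<dots> \<le> F" using assms(1) by (simp add: vnorm_square)
    finally show ?thesis .
  qed
  obtain k u where ku: "orthonormal q k u" "real k \<le> F / \<delta>\<^sup>2"
    "\<And>x. (\<forall>l<k. (\<Sum>j<q. x j * cnj (u l j)) = 0) \<Longrightarrow> Q x \<le> \<delta>\<^sup>2 * (vnorm q x)\<^sup>2"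
    using large_directions[of Q q F "\<delta>\<^sup>2"] scale zero trace assms(2) by auto
  let ?R = "\<lambda>i j. \<Sum>l<k. (\<Sum>a<q. M i a * u l a) * cnj (u l j)"
  have "rank_bound p q ?R (F / \<delta>\<^sup>2)" using ku(2)
    by (intro rank_boundI[where k = "k" and u = "\<lambda>l i. \<Sum>a<q. M i a * u l a" and v = "\<lambda>l j. cnj (u l j)"]) auto
  moreover have "norm_bound p q (\<lambda>i j. M i j - ?R i j) \<delta>"
  proof (rule norm_boundI)
    fix y x
    let ?x = "proj q k u x"
    have "Q ?x \<le> \<delta>\<^sup>2 * (vnorm q ?x)\<^sup>2" by (rule ku(3)) (simp add: proj_orthogonal[OF ku(1)])
    then have "(vnorm p (\<lambda>i. \<Sum>j<q. M i j * ?x j))\<^sup>2 \<le> (\<delta> * vnorm q ?x)\<^sup>2"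
      by (simp add: Q_def power_mult_distrib)
    then have "vnorm p (\<lambda>i. \<Sum>j<q. M i j * ?x j) \<le> \<delta> * vnorm q ?x"
      by (rule power2_le_imp_le) (use assms in simp)
    also have "\<dots> \<le> \<delta> * vnorm q x" using vnorm_proj[OF ku(1)] assms by simp
    finally have le: "vnorm p (\<lambda>i. \<Sum>j<q. M i j * ?x j) \<le> \<delta> * vnorm q x" .
    have "cmod (bilin p q M y ?x) = cmod (\<Sum>i<p. y i * (\<Sum>j<q. M i j * ?x j))"
      by (simp add: bilin_def sum_distrib_left mult.assoc)
    also have "\<dots> \<le> vnorm p y * vnorm p (\<lambda>i. \<Sum>j<q. M i j * ?x j)" by (rule cauchy_schwarz)
    also have "\<dots> \<le> vnorm p y * (\<delta> * vnorm q x)" using le by (intro mult_left_mono) auto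
    finally show "cmod (bilin p q (\<lambda>i j. M i j - ?R i j) y x) \<le> \<delta> * (vnorm p y * vnorm q x)"
      unfolding bilin_proj_right by (simp only: mult_ac)
  qed (use assms in simp)
  ultimately show ?thesis by (rule splitsI) simp
qed

text \<open>The trace norm counterpart of \<open>splits_frobenius\<close>: \<open>Q\<close> plays
  the role of a positive semidefinite form dominating the bilinear form. It is evaluated at both
  vectors, so large directions are removed on both sides, whence the factor 2 in the rank.\<close>

lemma splits_form:
  fixes Q :: "(nat \<Rightarrow> complex) \<Rightarrow> real"
  assumes scale: "\<forall>c x. Q (\<lambda>j. c * x j) = (cmod c)\<^sup>2 * Q x"
    and zero: "\<forall>x. vnorm m x = 0 \<longrightarrow> Q x \<le> 0"
    and trace: "\<forall>k u. orthonormal m k u \<longrightarrow> (\<Sum>l<k. Q (u l)) \<le> C"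
    and bound: "\<And>y x. cmod (bilin m m M y x) \<le> (Q (\<lambda>i. cnj (y i)) + Q x) / 2"
    and "0 < \<delta>"
  shows "splits m m M (2 * C / \<delta>) \<delta>"
proof -
  obtain k u where ku: "orthonormal m k u" "real k \<le> C / \<delta>"
    "\<And>x. (\<forall>l<k. (\<Sum>j<m. x j * cnj (u l j)) = 0) \<Longrightarrow> Q x \<le> \<delta> * (vnorm m x)\<^sup>2"
    using large_directions[OF scale zero trace \<open>0 < \<delta>\<close>] by blast
  have Q: "Q (proj m k u x) \<le> \<delta> * (vnorm m x)\<^sup>2" for x
  proof -
    have "Q (proj m k u x) \<le> \<delta> * (vnorm m (proj m k u x))\<^sup>2"
      by (rule ku(3)) (simp add: proj_orthogonal[OF ku(1)])
    also have "\<dots> \<le> \<delta> * (vnorm m x)\<^sup>2"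
      using \<open>0 < \<delta>\<close> by (intro mult_left_mono power_mono vnorm_proj ku(1)) auto
    finally show ?thesis .
  qed
  let ?R = "\<lambda>i j. \<Sum>l<k. (\<Sum>a<m. M i a * u l a) * cnj (u l j)"
  let ?M' = "\<lambda>i j. M i j - ?R i j"
  \<comment> \<open>Built from \<open>?M'\<close> and not from \<open>M\<close>, so that the
    remainder is \<open>M\<close> projected first on the right and then on the left.\<close>
  let ?R' = "\<lambda>i j. \<Sum>l<k. u l i * (\<Sum>a<m. cnj (u l a) * ?M' a j)"
  have "rank_bound m m ?R (C / \<delta>)" using ku(2)
    by (intro rank_boundI[where k = "k" and u = "\<lambda>l i. \<Sum>a<m. M i a * u l a" and v = "\<lambda>l j. cnj (u l j)"]) auto
  moreover have "rank_bound m m ?R' (C / \<delta>)" using ku(2)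
    by (intro rank_boundI[where k = "k" and u = u and v = "\<lambda>l j. \<Sum>a<m. cnj (u l a) * ?M' a j"]) auto
  ultimately have "rank_bound m m (\<lambda>i j. ?R i j + ?R' i j) (C / \<delta> + C / \<delta>)" by (rule rank_bound_add)
  moreover have "norm_bound m m (\<lambda>i j. ?M' i j - ?R' i j) \<delta>"
  proof (rule norm_boundI_quadratic)
    fix y x :: "nat \<Rightarrow> complex"
    let ?y = "\<lambda>i. cnj (y i)"
    have "cmod (bilin m m (\<lambda>i j. ?M' i j - ?R' i j) y x)
        = cmod (bilin m m M (\<lambda>i. cnj (proj m k u ?y i)) (proj m k u x))"
      unfolding bilin_proj_left bilin_proj_right ..
    also have "\<dots> \<le> (Q (proj m k u ?y) + Q (proj m k u x)) / 2"
      using bound[of "\<lambda>i. cnj (proj m k u ?y i)"] by simp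
    also have "\<dots> \<le> (\<delta> * (vnorm m ?y)\<^sup>2 + \<delta> * (vnorm m x)\<^sup>2) / 2"
      using Q[of ?y] Q[of x] by simp
    also have "\<dots> = \<delta> * ((vnorm m y)\<^sup>2 + (vnorm m x)\<^sup>2) / 2" by (simp add: distrib_left)
    finally show "cmod (bilin m m (\<lambda>i j. ?M' i j - ?R' i j) y x)
        \<le> \<delta> * ((vnorm m y)\<^sup>2 + (vnorm m x)\<^sup>2) / 2" .
  qed (use \<open>0 < \<delta>\<close> in simp)
  moreover have "a = (b + c) + (a - b - c)" for a b c :: complex by simp
  ultimately have "splits m m M (C / \<delta> + C / \<delta>) \<delta>" by (rule splitsI)
  then show ?thesis by simp
qed


section \<open>Corners of scalar Toeplitz matrices\<close>

abbreviation period :: "real measure" where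
  "period \<equiv> lebesgue_on {-pi..pi}"

definition fcoeff :: "(real \<Rightarrow> complex) \<Rightarrow> int \<Rightarrow> complex" where
  "fcoeff g k = 1 / (2 * complex_of_real pi) *
     (LINT \<theta>|period. g \<theta> * exp (- \<i> * of_int k * of_real \<theta>))"

definition trig :: "nat \<Rightarrow> (nat \<Rightarrow> complex) \<Rightarrow> real \<Rightarrow> complex" where
  "trig m x \<theta> = (\<Sum>j<m. x j * cis (real j * \<theta>))"

text \<open>The normalised L^1 norm, that is, the constant diagonal entry of the Toeplitz matrix of
  the modulus of \<open>g\<close>; the trace is \<open>m\<close> times this number.\<close>

definition mean_abs :: "(real \<Rightarrow> complex) \<Rightarrow> real" where
  "mean_abs g = (LINT \<theta>|period. cmod (g \<theta>)) / (2 * pi)"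

lemma continuous_measurable_period [measurable]:
  "continuous_on UNIV h \<Longrightarrow> h \<in> borel_measurable period"
  by (rule continuous_imp_measurable_on_sets_lebesgue) (auto intro: continuous_on_subset)

lemma continuous_trig [continuous_intros]: "continuous_on S (trig m x)"
  unfolding trig_def by (intro continuous_intros)

lemma integrable_mult_bounded:
  assumes "integrable period g" "continuous_on UNIV h" "\<And>\<theta>. cmod (h \<theta>) \<le> B"
  shows "integrable period (\<lambda>\<theta>. g \<theta> * h \<theta>)"
proof (rule Bochner_Integration.integrable_bound)
  show "integrable period (\<lambda>\<theta>. B *\<^sub>R g \<theta>)" using assms(1) by simp
  show "(\<lambda>\<theta>. g \<theta> * h \<theta>) \<in> borel_measurable period"
    using assms(1) continuous_measurable_period[OF assms(2)] by (intro borel_measurable_times) auto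
  have "cmod (g \<theta>) * cmod (h \<theta>) \<le> \<bar>B\<bar> * cmod (g \<theta>)" for \<theta>
    using mult_left_mono[of "cmod (h \<theta>)" "\<bar>B\<bar>" "cmod (g \<theta>)"] assms(3)[of \<theta>] by (simp add: mult.commute)
  then show "AE \<theta> in period. cmod (g \<theta> * h \<theta>) \<le> cmod (B *\<^sub>R g \<theta>)"
    by (simp add: norm_mult)
qed

lemma fcoeff_cis: "fcoeff g k = (LINT \<theta>|period. g \<theta> * cis (- (of_int k * \<theta>))) / (2 * complex_of_real pi)"
  by (simp add: fcoeff_def cis_conv_exp mult_ac)

lemma integrable_mult_cis:
  assumes "integrable period g"
  shows "integrable period (\<lambda>\<theta>. g \<theta> * cis (a * \<theta>))"
  by (rule integrable_mult_bounded[OF assms, where B = 1]) (auto intro!: continuous_intros)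

lemma fcoeff_add:
  assumes "integrable period g" "integrable period h"
  shows "fcoeff (\<lambda>\<theta>. g \<theta> + h \<theta>) k = fcoeff g k + fcoeff h k"
proof -
  have "integrable period (\<lambda>\<theta>. g \<theta> * cis (- (of_int k * \<theta>)))" if "integrable period g" for g
    using integrable_mult_cis[OF that, of "- of_int k"] by simp
  then show ?thesis using assms
    by (simp add: fcoeff_cis distrib_right add_divide_distrib)
qed

lemma cmod_trig_le: "cmod (trig m x \<theta>) \<le> (\<Sum>j<m. cmod (x j))"
  unfolding trig_def by (rule sum_norm_le) (simp add: norm_mult)

lemma integrable_mult_trig:
  assumes "integrable period g"
  shows "integrable period (\<lambda>\<theta>. g \<theta> * trig m x \<theta>)"
  using assms by (rule integrable_mult_bounded) (auto intro: continuous_intros cmod_trig_le)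

lemma integrable_mult_trig_square:
  assumes "integrable period g"
  shows "integrable period (\<lambda>\<theta>. cmod (g \<theta>) * (cmod (trig m x \<theta>))\<^sup>2)"
proof -
  have "integrable period (\<lambda>\<theta>. g \<theta> * (trig m x \<theta> * trig m x \<theta>))"
    using integrable_mult_trig[OF integrable_mult_trig[OF assms]] by (simp only: mult.assoc)
  then have "integrable period (\<lambda>\<theta>. cmod (g \<theta> * (trig m x \<theta> * trig m x \<theta>)))"
    by (rule integrable_norm)
  then show ?thesis by (simp add: norm_mult power2_eq_square)
qed

text \<open>The indices are negative because the discarded entries lie above the diagonal, where
  \<open>i - j < 0\<close>.\<close>

lemma integral_trig:
  assumes "integrable period g"
  shows "(\<Sum>k<n. c k * fcoeff g (- int k)) = (LINT \<theta>|period. g \<theta> * trig n c \<theta>) / (2 * complex_of_real pi)"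
proof -
  have "(LINT \<theta>|period. g \<theta> * trig n c \<theta>) = (LINT \<theta>|period. (\<Sum>k<n. c k * (g \<theta> * cis (real k * \<theta>))))"
    by (simp add: trig_def sum_distrib_left mult_ac)
  also have "\<dots> = (\<Sum>k<n. LINT \<theta>|period. c k * (g \<theta> * cis (real k * \<theta>)))"
    by (rule Bochner_Integration.integral_sum) (intro integrable_mult_right integrable_mult_cis assms)
  also have "\<dots> = (\<Sum>k<n. c k * (LINT \<theta>|period. g \<theta> * cis (real k * \<theta>)))" by simp
  finally show ?thesis by (simp add: fcoeff_cis sum_divide_distrib)
qed

text \<open>The two conjugations on the \<open>y\<close> side cancel on the coefficients and only
  reverse the frequencies, so the entry \<open>(i, j)\<close> is met by
  \<open>cis ((j - i) * \<theta>)\<close>, which integrates to the Fourier index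
  \<open>i - j\<close>.\<close>

lemma bilin_toeplitz:
  assumes "integrable period g"
  shows "bilin m m (\<lambda>i j. fcoeff g (int i - int j)) y x
    = (LINT \<theta>|period. g \<theta> * (cnj (trig m (\<lambda>i. cnj (y i)) \<theta>) * trig m x \<theta>)) / (2 * complex_of_real pi)"
proof -
  have "(LINT \<theta>|period. g \<theta> * (cnj (trig m (\<lambda>i. cnj (y i)) \<theta>) * trig m x \<theta>))
      = (LINT \<theta>|period. (\<Sum>i<m. \<Sum>j<m. y i * x j * (g \<theta> * cis ((real j - real i) * \<theta>))))"
  proof (rule Bochner_Integration.integral_cong[OF refl])
    fix \<theta>
    have "cnj (trig m (\<lambda>i. cnj (y i)) \<theta>) * trig m x \<theta>
        = (\<Sum>i<m. \<Sum>j<m. (y i * cis (- (real i * \<theta>))) * (x j * cis (real j * \<theta>)))"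
      by (simp add: trig_def cis_cnj sum_product)
    also have "\<dots> = (\<Sum>i<m. \<Sum>j<m. y i * x j * cis ((real j - real i) * \<theta>))"
    proof (intro sum.cong refl)
      fix i j
      have "(y i * cis (- (real i * \<theta>))) * (x j * cis (real j * \<theta>))
          = y i * x j * (cis (- (real i * \<theta>)) * cis (real j * \<theta>))" by (simp only: mult_ac)
      then show "(y i * cis (- (real i * \<theta>))) * (x j * cis (real j * \<theta>)) = y i * x j * cis ((real j - real i) * \<theta>)"
        by (simp only: cis_mult) (simp add: algebra_simps)
    qed
    finally show "g \<theta> * (cnj (trig m (\<lambda>i. cnj (y i)) \<theta>) * trig m x \<theta>)
        = (\<Sum>i<m. \<Sum>j<m. y i * x j * (g \<theta> * cis ((real j - real i) * \<theta>)))"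
      by (simp add: sum_distrib_left mult_ac)
  qed
  also have "\<dots> = (\<Sum>i<m. \<Sum>j<m. LINT \<theta>|period. y i * x j * (g \<theta> * cis ((real j - real i) * \<theta>)))"
    by (subst Bochner_Integration.integral_sum, intro Bochner_Integration.integrable_sum integrable_mult_right integrable_mult_cis assms,
        subst Bochner_Integration.integral_sum, intro integrable_mult_right integrable_mult_cis assms) (rule refl)
  also have "\<dots> = (\<Sum>i<m. \<Sum>j<m. y i * x j * (LINT \<theta>|period. g \<theta> * cis ((real j - real i) * \<theta>)))" by simp
  finally have "(LINT \<theta>|period. g \<theta> * (cnj (trig m (\<lambda>i. cnj (y i)) \<theta>) * trig m x \<theta>))
      / (2 * complex_of_real pi) = (\<Sum>i<m. \<Sum>j<m. y i * x j *
        ((LINT \<theta>|period. g \<theta> * cis ((real j - real i) * \<theta>)) / (2 * complex_of_real pi)))"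
    by (simp add: sum_divide_distrib)
  moreover have "fcoeff g (int i - int j)
      = (LINT \<theta>|period. g \<theta> * cis ((real j - real i) * \<theta>)) / (2 * complex_of_real pi)" for i j
    by (simp add: fcoeff_cis left_diff_distrib)
  ultimately show ?thesis unfolding bilin_def by (simp add: mult_ac)
qed

text \<open>Factor \<open>g\<close> into two functions of modulus \<open>\<surd>\<bar>g\<bar>\<close>: the bilinear form of the Toeplitz matrix
  is then controlled by the quadratic form of the Toeplitz matrix of \<open>\<bar>g\<bar>\<close>, whose trace is
  proportional to the \<open>L\<^sup>1\<close> norm of \<open>g\<close>.\<close>

lemma splits_toeplitz:
  assumes g: "integrable period g" and "0 < \<delta>"
  shows "splits m m (\<lambda>i j. fcoeff g (int i - int j)) (2 * (real m * mean_abs g) / \<delta>) \<delta>"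
proof -
  define Q where "Q x = (LINT \<theta>|period. cmod (g \<theta>) * (cmod (trig m x \<theta>))\<^sup>2) / (2 * pi)" for x
  note int = integrable_mult_trig_square[OF g]
  have "Q (\<lambda>j. c * x j) = (cmod c)\<^sup>2 * Q x" for c x
  proof -
    have eq: "cmod (g \<theta>) * (cmod (trig m (\<lambda>j. c * x j) \<theta>))\<^sup>2
        = (cmod c)\<^sup>2 * (cmod (g \<theta>) * (cmod (trig m x \<theta>))\<^sup>2)" for \<theta>
    proof -
      have "trig m (\<lambda>j. c * x j) \<theta> = c * trig m x \<theta>"
        by (simp add: trig_def sum_distrib_left mult_ac)
      then show ?thesis by (simp add: norm_mult power_mult_distrib)
    qed
    show ?thesis unfolding Q_def eq by simp
  qed
  moreover have "Q x \<le> 0" if "vnorm m x = 0" for x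
    using that by (simp add: Q_def vnorm_eq_0 trig_def)
  moreover have "(\<Sum>l<k. Q (u l)) \<le> real m * mean_abs g" if u: "orthonormal m k u" for k u
  proof -
    have "(\<Sum>l<k. LINT \<theta>|period. cmod (g \<theta>) * (cmod (trig m (u l) \<theta>))\<^sup>2)
        = (LINT \<theta>|period. (\<Sum>l<k. cmod (g \<theta>) * (cmod (trig m (u l) \<theta>))\<^sup>2))"
      by (rule Bochner_Integration.integral_sum[symmetric]) (rule int)
    also have "\<dots> \<le> (LINT \<theta>|period. real m * cmod (g \<theta>))"
    proof (rule integral_mono)
      fix \<theta> :: real
      \<comment> \<open>Bessel's inequality at a fixed \<theta>, tested with the vector of
        characters, whose squared norm is \<open>m\<close>.\<close>
      have "(\<Sum>l<k. (cmod (trig m (u l) \<theta>))\<^sup>2) \<le> (vnorm m (\<lambda>j. cis (real j * \<theta>)))\<^sup>2"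
        using bessel[OF u, of "\<lambda>j. cis (real j * \<theta>)"] by (simp add: trig_def mult.commute)
      then show "(\<Sum>l<k. cmod (g \<theta>) * (cmod (trig m (u l) \<theta>))\<^sup>2) \<le> real m * cmod (g \<theta>)"
        unfolding sum_distrib_left[symmetric] mult.commute[of "real m"]
        by (intro mult_left_mono) (simp_all add: vnorm_square)
    qed (use int g in auto)
    finally show ?thesis by (simp add: Q_def mean_abs_def sum_divide_distrib[symmetric] divide_right_mono)
  qed
  moreover have "cmod (bilin m m (\<lambda>i j. fcoeff g (int i - int j)) y x) \<le> (Q (\<lambda>i. cnj (y i)) + Q x) / 2"
    for y x
  proof -
    let ?Y = "trig m (\<lambda>i. cnj (y i))" and ?X = "trig m x"
    have "cmod (LINT \<theta>|period. g \<theta> * (cnj (?Y \<theta>) * ?X \<theta>))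
        \<le> (LINT \<theta>|period. (cmod (g \<theta>) * (cmod (?Y \<theta>))\<^sup>2 + cmod (g \<theta>) * (cmod (?X \<theta>))\<^sup>2) / 2)"
    proof (rule Bochner_Integration.integral_norm_bound_integral)
      show "integrable period (\<lambda>\<theta>. g \<theta> * (cnj (?Y \<theta>) * ?X \<theta>))"
      proof (rule integrable_mult_bounded[OF g])
        show "continuous_on UNIV (\<lambda>\<theta>. cnj (?Y \<theta>) * ?X \<theta>)" by (intro continuous_intros)
        show "cmod (cnj (?Y \<theta>) * ?X \<theta>) \<le> (\<Sum>j<m. cmod (cnj (y j))) * (\<Sum>j<m. cmod (x j))" for \<theta>
          unfolding norm_mult complex_mod_cnj by (intro mult_mono cmod_trig_le) (auto simp: sum_nonneg intro!: order_trans[OF cmod_trig_le])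
      qed
      show "integrable period (\<lambda>\<theta>. (cmod (g \<theta>) * (cmod (?Y \<theta>))\<^sup>2 + cmod (g \<theta>) * (cmod (?X \<theta>))\<^sup>2) / 2)"
        using int by simp
      fix \<theta>
      have "2 * (cmod (?Y \<theta>) * cmod (?X \<theta>)) \<le> (cmod (?Y \<theta>))\<^sup>2 + (cmod (?X \<theta>))\<^sup>2"
        using sum_squares_bound[of "cmod (?Y \<theta>)" "cmod (?X \<theta>)"] by simp
      then have "cmod (g \<theta>) * (2 * (cmod (?Y \<theta>) * cmod (?X \<theta>)))
          \<le> cmod (g \<theta>) * ((cmod (?Y \<theta>))\<^sup>2 + (cmod (?X \<theta>))\<^sup>2)" by (rule mult_left_mono) simp
      then show "cmod (g \<theta> * (cnj (?Y \<theta>) * ?X \<theta>))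
          \<le> (cmod (g \<theta>) * (cmod (?Y \<theta>))\<^sup>2 + cmod (g \<theta>) * (cmod (?X \<theta>))\<^sup>2) / 2"
        by (simp add: norm_mult distrib_left)
    qed
    also have "\<dots> = ((LINT \<theta>|period. cmod (g \<theta>) * (cmod (?Y \<theta>))\<^sup>2)
        + (LINT \<theta>|period. cmod (g \<theta>) * (cmod (?X \<theta>))\<^sup>2)) / 2" using int by simp
    finally have "cmod (LINT \<theta>|period. g \<theta> * (cnj (?Y \<theta>) * ?X \<theta>)) / (2 * pi)
        \<le> (Q (\<lambda>i. cnj (y i)) + Q x) / 2"
      unfolding Q_def by (simp add: field_simps)
    then show ?thesis by (simp add: bilin_toeplitz[OF g] norm_divide norm_mult)
  qed
  ultimately show ?thesis using \<open>0 < \<delta>\<close> by (intro splits_form[of Q]) auto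
qed

section \<open>Parseval and Bessel on the period\<close>

lemma integral_cis:
  fixes k :: int
  shows "(LINT \<theta>|period. cis (of_int k * \<theta>)) = (if k = 0 then 2 * complex_of_real pi else 0)"
proof -
  have int: "integrable period (\<lambda>\<theta>. cis (of_int k * \<theta>))"
    by (intro continuous_imp_integrable_real continuous_intros)
  show ?thesis
  proof (cases "k = 0")
    case True
    then show ?thesis by (simp add: measure_restrict_space scaleR_conv_of_real)
  next
    case False
    have i: "- (\<i> * (z * \<i>)) = z" for z
    proof -
      have "\<i> * (z * \<i>) = (\<i> * \<i>) * z" by (simp only: mult_ac)
      then show ?thesis by simp
    qed
    let ?F = "\<lambda>\<theta>. cis (of_int k * \<theta>) / (\<i> * of_int k)"
    have "((\<lambda>\<theta>. cis (of_int k * \<theta>)) has_integral (?F pi - ?F (- pi))) {-pi..pi}"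
    proof (rule fundamental_theorem_of_calculus)
      fix \<theta> assume "\<theta> \<in> {-pi..pi}"
      have "((\<lambda>z. exp (\<i> * (of_int k * z)) / (\<i> * of_int k)) has_field_derivative
          exp (\<i> * (of_int k * of_real \<theta>))) (at (of_real \<theta>))"
        using False by (auto intro!: derivative_eq_intros simp: i)
      from has_vector_derivative_real_field[OF this]
      show "(?F has_vector_derivative cis (of_int k * \<theta>)) (at \<theta> within {-pi..pi})"
        by (simp add: cis_conv_exp)
    qed simp
    moreover have "cis (of_int k * pi) = cis (- (of_int k * pi))"
      by (rule complex_eqI) (simp_all add: sin_int_times_real mult.commute)
    ultimately have "((\<lambda>\<theta>. cis (of_int k * \<theta>)) has_integral 0) {-pi..pi}" by simp
    then show ?thesis using False int by (simp add: lebesgue_integral_eq_integral integral_unique)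
  qed
qed

text \<open>Parseval: by orthogonality of the characters only the diagonal of the double sum
  survives.\<close>

lemma integral_trig_square:
  "(LINT \<theta>|period. (cmod (trig m x \<theta>))\<^sup>2) = 2 * pi * (vnorm m x)\<^sup>2"
proof -
  have int: "integrable period (\<lambda>\<theta>. c * cis (a * \<theta>))" for a c
    by (intro continuous_imp_integrable_real continuous_intros)
  have "complex_of_real (LINT \<theta>|period. (cmod (trig m x \<theta>))\<^sup>2)
      = (LINT \<theta>|period. complex_of_real ((cmod (trig m x \<theta>))\<^sup>2))"
    by (rule integral_of_real[symmetric]) (intro continuous_imp_integrable_real continuous_intros)
  also have "\<dots> = (LINT \<theta>|period. (\<Sum>i<m. \<Sum>j<m. x i * cnj (x j) * cis (of_int (int i - int j) * \<theta>)))"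
  proof (rule Bochner_Integration.integral_cong[OF refl])
    fix \<theta>
    have "complex_of_real ((cmod (trig m x \<theta>))\<^sup>2)
        = (\<Sum>i<m. \<Sum>j<m. (x i * cis (real i * \<theta>)) * (cnj (x j) * cis (- (real j * \<theta>))))"
      by (simp only: complex_norm_square trig_def cnj_sum sum_product complex_cnj_mult cis_cnj)
    also have "\<dots> = (\<Sum>i<m. \<Sum>j<m. x i * cnj (x j) * cis (of_int (int i - int j) * \<theta>))"
    proof (intro sum.cong refl)
      fix i j
      have "(x i * cis (real i * \<theta>)) * (cnj (x j) * cis (- (real j * \<theta>)))
          = x i * cnj (x j) * (cis (real i * \<theta>) * cis (- (real j * \<theta>)))" by (simp only: mult_ac)
      then show "(x i * cis (real i * \<theta>)) * (cnj (x j) * cis (- (real j * \<theta>)))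
          = x i * cnj (x j) * cis (of_int (int i - int j) * \<theta>)"
        by (simp only: cis_mult) (simp add: algebra_simps)
    qed
    finally show "complex_of_real ((cmod (trig m x \<theta>))\<^sup>2)
        = (\<Sum>i<m. \<Sum>j<m. x i * cnj (x j) * cis (of_int (int i - int j) * \<theta>))" .
  qed
  also have "\<dots> = (\<Sum>i<m. \<Sum>j<m. LINT \<theta>|period. x i * cnj (x j) * cis (of_int (int i - int j) * \<theta>))"
    by (subst Bochner_Integration.integral_sum, intro Bochner_Integration.integrable_sum int,
        subst Bochner_Integration.integral_sum, intro int) (rule refl)
  also have "\<dots> = (\<Sum>i<m. \<Sum>j<m. x i * cnj (x j) * (LINT \<theta>|period. cis (of_int (int i - int j) * \<theta>)))"
    by (simp only: integral_mult_right_zero)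
  also have "\<dots> = (\<Sum>i<m. \<Sum>j<m. if i = j then x i * cnj (x j) * (2 * complex_of_real pi) else 0)"
    unfolding integral_cis by (intro sum.cong) auto
  also have "\<dots> = (\<Sum>i<m. x i * cnj (x i)) * (2 * complex_of_real pi)"
    by (simp add: sum_distrib_right)
  also have "\<dots> = complex_of_real (2 * pi * (vnorm m x)\<^sup>2)"
    by (simp only: of_real_vnorm_square of_real_mult mult.commute of_real_numeral)
  finally show ?thesis by (simp only: of_real_eq_iff)
qed

text \<open>The same duality argument as for \<open>bessel\<close>.\<close>

lemma bessel_fourier:
  assumes b: "integrable period b" and le: "\<And>\<theta>. cmod (b \<theta>) \<le> B"
  shows "(\<Sum>k<n. (cmod (fcoeff b (- int k)))\<^sup>2) \<le> B\<^sup>2"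
proof -
  define c where "c k = cnj (fcoeff b (- int k))" for k
  let ?S = "\<Sum>k<n. (cmod (fcoeff b (- int k)))\<^sup>2"
  have int: "integrable period (\<lambda>\<theta>. (cmod (trig n c \<theta>))\<^sup>2)"
    by (intro continuous_imp_integrable_real continuous_intros)
  have const: "integrable period (\<lambda>\<theta>. B\<^sup>2)"
    by (intro continuous_imp_integrable_real continuous_intros)
  have vnorm: "(vnorm n c)\<^sup>2 = ?S" by (simp add: vnorm_square c_def)
  have "complex_of_real ?S = (\<Sum>k<n. c k * fcoeff b (- int k))"
    unfolding of_real_sum complex_norm_square c_def by (intro sum.cong refl mult.commute)
  also have "\<dots> = (LINT \<theta>|period. b \<theta> * trig n c \<theta>) / (2 * complex_of_real pi)"
    by (rule integral_trig[OF b])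
  finally have "\<bar>?S\<bar> = cmod ((LINT \<theta>|period. b \<theta> * trig n c \<theta>) / (2 * complex_of_real pi))"
    by (metis norm_of_real)
  then have "?S = cmod (LINT \<theta>|period. b \<theta> * trig n c \<theta>) / (2 * pi)"
    by (simp add: norm_divide norm_mult sum_nonneg)
  also have "\<dots> \<le> (LINT \<theta>|period. (B\<^sup>2 + (cmod (trig n c \<theta>))\<^sup>2) / 2) / (2 * pi)"
  proof (rule divide_right_mono, rule Bochner_Integration.integral_norm_bound_integral)
    show "integrable period (\<lambda>\<theta>. b \<theta> * trig n c \<theta>)" by (rule integrable_mult_trig[OF b])
    show "integrable period (\<lambda>\<theta>. (B\<^sup>2 + (cmod (trig n c \<theta>))\<^sup>2) / 2)" using int const by simp
    fix \<theta>
    have "cmod (b \<theta> * trig n c \<theta>) \<le> B * cmod (trig n c \<theta>)"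
      unfolding norm_mult by (intro mult_right_mono le) simp
    then show "cmod (b \<theta> * trig n c \<theta>) \<le> (B\<^sup>2 + (cmod (trig n c \<theta>))\<^sup>2) / 2"
      using sum_squares_bound[of B "cmod (trig n c \<theta>)"] by simp
  qed simp
  also have "(LINT \<theta>|period. (B\<^sup>2 + (cmod (trig n c \<theta>))\<^sup>2) / 2)
      = ((LINT \<theta>|period. B\<^sup>2) + (LINT \<theta>|period. (cmod (trig n c \<theta>))\<^sup>2)) / 2"
    using int const by simp
  also have "(LINT \<theta>|period. B\<^sup>2) = 2 * pi * B\<^sup>2"
    by (simp add: measure_restrict_space)
  \<comment> \<open>Parseval turns the trigonometric polynomial with coefficients \<open>c\<close>
    back into \<open>?S\<close>, which occurs with weight one half and is absorbed on the
    left.\<close>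
  finally have "?S \<le> (2 * pi * B\<^sup>2 + 2 * pi * ?S) / 2 / (2 * pi)"
    by (simp only: integral_trig_square vnorm)
  also have "\<dots> = (B\<^sup>2 + ?S) / 2" by (simp add: field_simps)
  finally show ?thesis by simp
qed

text \<open>All rows before the cut \<open>c\<close> are kept, not only those of one part, so that
  the matrix depends on a single number; the restriction to a part is left to a pullback.\<close>

definition corner :: "nat \<Rightarrow> (real \<Rightarrow> complex) \<Rightarrow> nat \<Rightarrow> nat \<Rightarrow> complex" where
  "corner c g i j = (if i < c \<and> c \<le> j then fcoeff g (int i - int j) else 0)"

text \<open>Only the last \<open>K\<close> rows above the cut involve Fourier coefficients of index less than \<open>K\<close>.\<close>

lemma splits_corner_bounded:
  assumes b: "integrable period b" "\<And>\<theta>. cmod (b \<theta>) \<le> B" and "0 < \<delta>" "0 < \<eta>"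
  obtains K where "\<And>m c. splits m m (corner c b) (real K + real m * \<eta> / \<delta>\<^sup>2) \<delta>"
proof -
  define h where "h k = (cmod (fcoeff b (- int k)))\<^sup>2" for k
  have "summable h"
    by (rule summableI_nonneg_bounded[where x = "B\<^sup>2"])
      (use bessel_fourier[OF b] in \<open>auto simp: h_def\<close>)
  \<comment> \<open>\<open>K\<close> is chosen before the size \<open>m\<close> and the cut
    \<open>c\<close>, hence the uniformity in both.\<close>
  then obtain K where K: "\<And>n. norm (sum h {K..<n}) < \<eta>"
    using \<open>0 < \<eta>\<close> unfolding summable_Cauchy by blast
  have "splits m m (corner c b) (real K + real m * \<eta> / \<delta>\<^sup>2) \<delta>" for m c
  proof -
    define R where "R i j = (if c \<le> i + K then corner c b i j else 0)" for i j
    define N where "N i j = (if c \<le> i + K then 0 else corner c b i j)" for i j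
    have "rank_bound m m R (real (card {c - K..<c}))"
      by (rule rank_bound_rows) (auto simp: R_def corner_def)
    then have "rank_bound m m R (real K)" by (rule rank_bound_mono) simp
    then have 1: "splits m m R (real K) 0"
      by (rule splitsI) (auto intro: norm_bound_zero)
    have row: "(\<Sum>j<m. (cmod (N i j))\<^sup>2) \<le> \<eta>" for i
    proof (cases "i + K < c")
      case True
      \<comment> \<open>Within a row the indices \<open>j - i\<close> are distinct and at least
        \<open>K\<close>, so the row is bounded by a tail of the series.\<close>
      have "(\<Sum>j<m. (cmod (N i j))\<^sup>2) = (\<Sum>j\<in>{c..<m}. h (j - i))"
        using True by (intro sum.mono_neutral_cong_right) (auto simp: N_def corner_def h_def of_nat_diff)
      also have "\<dots> = sum h ((\<lambda>j. j - i) ` {c..<m})"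
        using True by (subst sum.reindex) (auto simp: inj_on_def)
      also have "\<dots> \<le> sum h {K..<m}"
        using True by (intro sum_mono2) (auto simp: h_def)
      also have "\<dots> \<le> \<eta>" using K[of m] by simp
      finally show ?thesis .
    next
      case False
      then show ?thesis using \<open>0 < \<eta>\<close> by (simp add: N_def)
    qed
    have "(\<Sum>i<m. \<Sum>j<m. (cmod (N i j))\<^sup>2) \<le> (\<Sum>i<m. \<eta>)"
      by (intro sum_mono row)
    then have "(\<Sum>i<m. \<Sum>j<m. (cmod (N i j))\<^sup>2) \<le> real m * \<eta>" by simp
    then have "splits m m N (real m * \<eta> / \<delta>\<^sup>2) \<delta>"
      using \<open>0 < \<delta>\<close> by (rule splits_frobenius)
    from splits_add[OF 1 this] show ?thesis
      by (simp only: add_0) (erule splits_cong, simp add: R_def N_def)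
  qed
  then show ?thesis using that by blast
qed

section \<open>Corners for an integrable function\<close>

lemma mean_abs_truncation:
  assumes f: "integrable period f"
  shows "(\<lambda>n. mean_abs (\<lambda>\<theta>. if cmod (f \<theta>) \<le> real n then 0 else f \<theta>)) \<longlonglongrightarrow> 0"
proof -
  have [measurable]: "f \<in> borel_measurable period" using f by auto
  have "(\<lambda>n. LINT \<theta>|period. cmod (if cmod (f \<theta>) \<le> real n then 0 else f \<theta>))
      \<longlonglongrightarrow> (LINT \<theta>|period. 0)"
  proof (rule integral_dominated_convergence)
    show "integrable period (\<lambda>\<theta>. cmod (f \<theta>))" using f by simp
    show "AE \<theta> in period. (\<lambda>n. cmod (if cmod (f \<theta>) \<le> real n then 0 else f \<theta>)) \<longlonglongrightarrow> 0"
    proof (rule AE_I2)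
      fix \<theta>
      have "\<forall>\<^sub>F n in sequentially. cmod (f \<theta>) \<le> real n"
        using eventually_ge_at_top[of "nat \<lceil>cmod (f \<theta>)\<rceil>"] by eventually_elim linarith
      then have "\<forall>\<^sub>F n in sequentially. cmod (if cmod (f \<theta>) \<le> real n then 0 else f \<theta>) = 0"
        by eventually_elim simp
      then show "(\<lambda>n. cmod (if cmod (f \<theta>) \<le> real n then 0 else f \<theta>)) \<longlonglongrightarrow> 0"
        by (rule tendsto_eventually)
    qed
  qed (auto intro!: AE_I2)
  then show ?thesis unfolding mean_abs_def by (auto intro: tendsto_divide_zero)
qed

text \<open>The threshold \<open>m0\<close> serves all cuts at once, because both ingredients are
  uniform: the tail index for the bounded part and the trace bound for the whole Toeplitz matrix of
  the rest.\<close>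

lemma splits_corner:
  assumes f: "integrable period f" and "0 < \<epsilon>"
  obtains m0 where "\<And>m c. m \<ge> m0 \<Longrightarrow> splits m m (corner c f) (\<epsilon> * real m) \<epsilon>"
proof -
  have [measurable]: "f \<in> borel_measurable period" using f by auto
  have "\<forall>\<^sub>F n in sequentially. mean_abs (\<lambda>\<theta>. if cmod (f \<theta>) \<le> real n then 0 else f \<theta>) < \<epsilon>\<^sup>2 / 8"
    by (rule order_tendstoD(2)[OF mean_abs_truncation[OF f]]) (use \<open>0 < \<epsilon>\<close> in simp)
  \<comment> \<open>With norm level \<open>\<epsilon> / 2\<close> the rank spent on the small part
    is \<open>2 * m * mean_abs g / (\<epsilon> / 2)\<close>, and
    \<open>\<epsilon>\<^sup>2 / 8\<close> keeps it below \<open>\<epsilon> * m / 2\<close>.\<close>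
  then obtain n where n: "mean_abs (\<lambda>\<theta>. if cmod (f \<theta>) \<le> real n then 0 else f \<theta>) < \<epsilon>\<^sup>2 / 8"
    using eventually_happens trivial_limit_sequentially by blast
  define g where "g \<theta> = (if cmod (f \<theta>) \<le> real n then 0 else f \<theta>)" for \<theta>
  define b where "b \<theta> = (if cmod (f \<theta>) \<le> real n then f \<theta> else 0)" for \<theta>
  have g: "integrable period g" unfolding g_def
    by (rule Bochner_Integration.integrable_bound[OF f]) (auto intro!: AE_I2)
  have b: "integrable period b" unfolding b_def
    by (rule Bochner_Integration.integrable_bound[OF f]) (auto intro!: AE_I2)
  have b_le: "cmod (b \<theta>) \<le> real n" for \<theta> by (simp add: b_def)
  have "f = (\<lambda>\<theta>. b \<theta> + g \<theta>)" by (auto simp: b_def g_def)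
  then have corner: "corner c f i j = corner c b i j + corner c g i j" for c i j
    by (simp add: corner_def fcoeff_add[OF b g])
  \<comment> \<open>At level \<open>\<epsilon> / 2\<close> the constant
    \<open>\<epsilon> ^ 3 / 16\<close> costs rank \<open>\<epsilon> * m / 4\<close>; the same amount
    remains for the \<open>K\<close> rows next to the cut, once \<open>m\<close> is at least
    \<open>4 * K / \<epsilon>\<close>.\<close>
  obtain K where K: "\<And>m c. splits m m (corner c b) (real K + real m * (\<epsilon> ^ 3 / 16) / (\<epsilon> / 2)\<^sup>2) (\<epsilon> / 2)"
    using splits_corner_bounded[OF b b_le, of "\<epsilon> / 2" "\<epsilon> ^ 3 / 16"] \<open>0 < \<epsilon>\<close> by (auto simp: zero_less_power)
  show ?thesis
  proof (rule that[of "nat \<lceil>4 * real K / \<epsilon>\<rceil>"])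
    fix m c assume "m \<ge> nat \<lceil>4 * real K / \<epsilon>\<rceil>"
    then have "4 * real K / \<epsilon> \<le> real m" by linarith
    then have K_le: "real K \<le> \<epsilon> * real m / 4" using \<open>0 < \<epsilon>\<close> by (simp add: field_simps)
    have "real m * (\<epsilon> ^ 3 / 16) / (\<epsilon> / 2)\<^sup>2 = \<epsilon> * real m / 4"
      using \<open>0 < \<epsilon>\<close> by (simp add: power2_eq_square power3_eq_cube field_simps)
    then have 1: "splits m m (corner c b) (\<epsilon> * real m / 2) (\<epsilon> / 2)"
      using splits_mono[OF K[of m c]] K_le by simp
    have "splits m m (\<lambda>i j. fcoeff g (int i - int j)) (2 * (real m * mean_abs g) / (\<epsilon> / 2)) (\<epsilon> / 2)"
      using \<open>0 < \<epsilon>\<close> by (intro splits_toeplitz g) simp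
    moreover have "real m * mean_abs g \<le> real m * (\<epsilon>\<^sup>2 / 8)"
      using n unfolding g_def by (intro mult_left_mono) auto
    then have "2 * (real m * mean_abs g) / (\<epsilon> / 2) \<le> \<epsilon> * real m / 2"
      using \<open>0 < \<epsilon>\<close> by (simp add: power2_eq_square field_simps)
    ultimately have "splits m m (\<lambda>i j. fcoeff g (int i - int j)) (\<epsilon> * real m / 2) (\<epsilon> / 2)"
      by (rule splits_mono) simp
    \<comment> \<open>The trace bound concerns the whole Toeplitz matrix; cutting it down to the
      corner afterwards increases neither rank nor norm.\<close>
    then have "splits m m (\<lambda>i j. (if i < c then 1 else 0) * (if c \<le> j then 1 else 0) *
        fcoeff g (int (id i) - int (id j))) (\<epsilon> * real m / 2) (\<epsilon> / 2 * 1)"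
      by (rule splits_pullback) auto
    then have 2: "splits m m (corner c g) (\<epsilon> * real m / 2) (\<epsilon> / 2)"
      by (simp only: mult_1_right) (erule splits_cong, simp add: corner_def)
    from splits_add[OF 1 2] have "splits m m (\<lambda>i j. corner c b i j + corner c g i j) (\<epsilon> * real m) \<epsilon>"
      by simp
    then show "splits m m (corner c f) (\<epsilon> * real m) \<epsilon>"
      by (rule splits_cong) (simp add: corner)
  qed
qed


section \<open>Rank and operator norm\<close>

text \<open>A rank factorization: a maximal independent set of columns has \<open>rank R\<close>
  elements, and every column is a combination of them.\<close>

lemma rank_bound_rank:
  assumes R: "R \<in> carrier_mat p q"
  shows "rank_bound p q (\<lambda>i j. R $$ (i, j)) (real (vec_space.rank p R))"
proof -
  interpret vec_space "TYPE(complex)" p .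
  have cols: "set (Matrix.cols R) \<subseteq> carrier_vec p" using cols_dim[of R] R by simp
  obtain S where max: "maximal S (\<lambda>T. T \<subseteq> set (Matrix.cols R) \<and> lin_indpt T)"
    using maximal_exists_superset[of "set (Matrix.cols R)" "\<lambda>T. T \<subseteq> set (Matrix.cols R) \<and> lin_indpt T" "{}"]
    by (meson List.finite_set empty_iff empty_subsetI finite_lin_indpt2 rev_finite_subset)
  then have S: "S \<subseteq> set (Matrix.cols R)" "lin_indpt S" by (auto simp: maximal_def)
  then have fin: "finite S" and SV: "S \<subseteq> carrier_vec p" using cols finite_subset by blast+
  have rank: "rank R = card S" by (rule rank_card_indpt[OF R max])
  have "\<exists>a. \<forall>i<p. R $$ (i, j) = (\<Sum>x\<in>S. a x * vec_index x i)" if "j < q" for j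
  proof -
    have c: "Matrix.col R j \<in> set (Matrix.cols R)" using that R by (simp add: cols_def)
    then have cV: "Matrix.col R j \<in> carrier_vec p" using cols by blast
    have "Matrix.col R j \<in> span S"
    proof (cases "Matrix.col R j \<in> S")
      case True
      then show ?thesis using span_mem[of S] SV by auto
    next
      case False
      then have "\<not> lin_indpt (S \<union> {Matrix.col R j})"
        using max c S(1) unfolding maximal_def by blast
      then show ?thesis using lin_dep_iff_in_span[of S] SV S(2) cV False by auto
    qed
    then obtain a where "Matrix.col R j = lincomb a S"
      using finite_span[OF fin] SV by auto
    then have "vec_index (Matrix.col R j) i = (\<Sum>x\<in>S. a x * vec_index x i)" if "i < p" for i
      using lincomb_index[OF that SV] by simp
    then show ?thesis using R that by (intro exI[of _ a]) simp
  qed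
  then obtain a where a: "\<And>i j. i < p \<Longrightarrow> j < q \<Longrightarrow> R $$ (i, j) = (\<Sum>x\<in>S. a j x * vec_index x i)"
    by metis
  obtain e where e: "bij_betw e {..<card S} S"
    using bij_betw_from_nat_into_finite[OF fin] by blast
  have "R $$ (i, j) = (\<Sum>l<card S. vec_index (e l) i * a j (e l))" if "i < p" "j < q" for i j
    using a[OF that] sum.reindex_bij_betw[OF e, of "\<lambda>x. a j x * vec_index x i"] by (simp add: mult.commute)
  then show ?thesis unfolding rank by (intro rank_boundI[OF order_refl])
qed

text \<open>Subadditivity of the rank, each product contributing at most 1.\<close>

lemma rank_le_rank_bound:
  assumes "rank_bound p q M r"
  shows "real (vec_space.rank p (Matrix.mat p q (\<lambda>(i, j). M i j))) \<le> r"
proof -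
  interpret vec_space "TYPE(complex)" p .
  obtain k u v where k: "real k \<le> r" and M: "\<And>i j. i < p \<Longrightarrow> j < q \<Longrightarrow> M i j = (\<Sum>l<k. u l i * v l j)"
    using assms unfolding rank_bound_def by blast
  define X where "X k = Matrix.mat p q (\<lambda>(i, j). \<Sum>l<k. u l i * v l j)" for k
  have "rank (X k) \<le> k" for k
  proof (induction k)
    case 0
    have "X 0 = 0\<^sub>m p q" by (rule eq_matI) (auto simp: X_def)
    then show ?case by (simp add: rank_0I)
  next
    case (Suc k)
    let ?Y = "Matrix.mat p q (\<lambda>(i, j). u k i * v k j)"
    have "X (Suc k) = X k + ?Y" by (rule eq_matI) (auto simp: X_def)
    moreover have "rank (X k + ?Y) \<le> rank (X k) + rank ?Y"
      by (rule rank_subadditive) (auto simp: X_def)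
    moreover have "rank ?Y \<le> 1"
      by (rule rank_le_1_product_entries[where f = "u k" and g = "v k"]) auto
    ultimately show ?case using Suc by simp
  qed
  moreover have "Matrix.mat p q (\<lambda>(i, j). M i j) = X k"
    by (rule eq_matI) (auto simp: X_def M)
  ultimately show ?thesis using k by (metis of_nat_mono order_trans)
qed

lemma euclidean_norm_vnorm: "euclidean_norm v = vnorm (dim_vec v) (vec_index v)"
  by (simp add: euclidean_norm_def vnorm_def)

lemma vnorm_cong: "(\<And>i. i < n \<Longrightarrow> x i = y i) \<Longrightarrow> vnorm n x = vnorm n y"
  by (simp add: vnorm_def cong: L2_set_cong_simp)

lemma euclidean_norm_mult_mat_vec:
  assumes "N \<in> carrier_mat p q" "x \<in> carrier_vec q"
  shows "euclidean_norm (N *\<^sub>v x) = vnorm p (\<lambda>i. \<Sum>j<q. N $$ (i, j) * vec_index x j)"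
  unfolding euclidean_norm_vnorm using assms
  by (auto simp: scalar_prod_def atLeast0LessThan intro!: vnorm_cong sum.cong)

text \<open>A supremum of reals dominates its members only once the set is known to be bounded;
  Cauchy-Schwarz in every row gives a crude bound.\<close>

lemma bdd_above_operator_norm:
  assumes N: "N \<in> carrier_mat p q"
  shows "bdd_above ((\<lambda>x. euclidean_norm (N *\<^sub>v x)) ` {x \<in> carrier_vec (dim_col N). euclidean_norm x \<le> 1})"
proof (rule bdd_aboveI2)
  fix x assume "x \<in> {x \<in> carrier_vec (dim_col N). euclidean_norm x \<le> 1}"
  then have x: "x \<in> carrier_vec q" "vnorm q (vec_index x) \<le> 1"
    using N by (auto simp: euclidean_norm_vnorm)
  have "euclidean_norm (N *\<^sub>v x) \<le> (\<Sum>i<p. cmod (\<Sum>j<q. N $$ (i, j) * vec_index x j))"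
    unfolding euclidean_norm_mult_mat_vec[OF N x(1)] vnorm_def by (rule L2_set_le_sum) simp
  also have "\<dots> \<le> (\<Sum>i<p. vnorm q (\<lambda>j. N $$ (i, j)))"
  proof (rule sum_mono)
    fix i
    have "cmod (\<Sum>j<q. N $$ (i, j) * vec_index x j) \<le> vnorm q (\<lambda>j. N $$ (i, j)) * vnorm q (vec_index x)"
      by (rule cauchy_schwarz)
    also have "\<dots> \<le> vnorm q (\<lambda>j. N $$ (i, j))" using x(2) by (simp add: mult_left_le)
    finally show "cmod (\<Sum>j<q. N $$ (i, j) * vec_index x j) \<le> vnorm q (\<lambda>j. N $$ (i, j))" .
  qed
  finally show "euclidean_norm (N *\<^sub>v x) \<le> (\<Sum>i<p. vnorm q (\<lambda>j. N $$ (i, j)))" .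
qed

lemma norm_bound_operator_norm:
  assumes N: "N \<in> carrier_mat p q"
  shows "norm_bound p q (\<lambda>i j. N $$ (i, j)) (operator_norm N)"
proof (rule norm_boundI)
  have upper: "euclidean_norm (N *\<^sub>v x) \<le> operator_norm N"
    if "x \<in> carrier_vec q" "euclidean_norm x \<le> 1" for x
    unfolding operator_norm_def
    by (rule cSUP_upper[OF _ bdd_above_operator_norm[OF N]]) (use that N in auto)
  \<comment> \<open>The zero vector lies in the unit ball even if there are no columns, so the
    supremum is nonnegative.\<close>
  have "euclidean_norm (0\<^sub>v q) = 0" by (simp add: euclidean_norm_vnorm vnorm_eq_0)
  then have "euclidean_norm (N *\<^sub>v 0\<^sub>v q) \<le> operator_norm N" by (intro upper) auto
  then show "0 \<le> operator_norm N"
    by (rule order_trans[rotated]) (simp add: euclidean_norm_vnorm)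
  fix y x
  show "cmod (bilin p q (\<lambda>i j. N $$ (i, j)) y x) \<le> operator_norm N * (vnorm p y * vnorm q x)"
  proof (cases "vnorm q x = 0")
    case True
    then have "bilin p q (\<lambda>i j. N $$ (i, j)) y x = 0" by (simp add: bilin_def vnorm_eq_0)
    with True show ?thesis by simp
  next
    case False
    then have pos: "vnorm q x > 0" using vnorm_nonneg[of q x] by linarith
    define e where "e = Matrix.vec q (\<lambda>j. complex_of_real (1 / vnorm q x) * x j)"
    have "vnorm q (vec_index e) = vnorm q (\<lambda>j. complex_of_real (1 / vnorm q x) * x j)"
      by (rule vnorm_cong) (simp add: e_def)
    also have "\<dots> = 1" unfolding vnorm_scale norm_of_real using pos by simp
    finally have e: "e \<in> carrier_vec q" "euclidean_norm e \<le> 1"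
      by (auto simp: euclidean_norm_vnorm e_def)
    let ?z = "\<lambda>i. \<Sum>j<q. N $$ (i, j) * vec_index e j"
    have xe: "x j = complex_of_real (vnorm q x) * vec_index e j" if "j < q" for j
      using pos that by (simp add: e_def)
    have "bilin p q (\<lambda>i j. N $$ (i, j)) y x = (\<Sum>i<p. \<Sum>j<q. y i * N $$ (i, j) * (complex_of_real (vnorm q x) * vec_index e j))"
      unfolding bilin_def by (intro sum.cong refl) (simp add: xe[symmetric])
    also have "\<dots> = complex_of_real (vnorm q x) * (\<Sum>i<p. y i * ?z i)"
      by (simp add: sum_distrib_left mult_ac)
    finally have "cmod (bilin p q (\<lambda>i j. N $$ (i, j)) y x) = vnorm q x * cmod (\<Sum>i<p. y i * ?z i)"
      by (simp add: norm_mult)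
    also have "\<dots> \<le> vnorm q x * (vnorm p y * vnorm p ?z)"
      by (intro mult_left_mono cauchy_schwarz) simp
    also have "\<dots> \<le> vnorm q x * (vnorm p y * operator_norm N)"
      using upper[OF e] unfolding euclidean_norm_mult_mat_vec[OF N e(1)] by (intro mult_left_mono) auto
    finally show ?thesis by (simp only: mult_ac)
  qed
qed

text \<open>Duality: with the conjugate of \<open>M x\<close> on the left the form equals
  \<open>|M x|^2\<close>, and one factor \<open>|M x|\<close> cancels.\<close>

lemma operator_norm_le:
  assumes "norm_bound p q M w"
  shows "operator_norm (Matrix.mat p q (\<lambda>(i, j). M i j)) \<le> w"
  unfolding operator_norm_def
proof (rule cSUP_least)
  let ?N = "Matrix.mat p q (\<lambda>(i, j). M i j)"
  have "euclidean_norm (0\<^sub>v q) = 0" by (simp add: euclidean_norm_vnorm vnorm_eq_0)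
  then have "0\<^sub>v q \<in> {x \<in> carrier_vec (dim_col ?N). euclidean_norm x \<le> 1}" by simp
  then show "{x \<in> carrier_vec (dim_col ?N). euclidean_norm x \<le> 1} \<noteq> {}" by blast
  fix x assume "x \<in> {x \<in> carrier_vec (dim_col ?N). euclidean_norm x \<le> 1}"
  then have x: "x \<in> carrier_vec q" "vnorm q (vec_index x) \<le> 1" by (auto simp: euclidean_norm_vnorm)
  let ?z = "\<lambda>i. \<Sum>j<q. M i j * vec_index x j"
  have "euclidean_norm (?N *\<^sub>v x) = vnorm p (\<lambda>i. \<Sum>j<q. ?N $$ (i, j) * vec_index x j)"
    by (rule euclidean_norm_mult_mat_vec) (use x in auto)
  also have "\<dots> = vnorm p ?z" by (rule vnorm_cong) simp
  finally have norm: "euclidean_norm (?N *\<^sub>v x) = vnorm p ?z" .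
  have "complex_of_real ((vnorm p ?z)\<^sup>2) = (\<Sum>i<p. cnj (?z i) * ?z i)"
    unfolding of_real_vnorm_square by (simp only: mult.commute)
  also have "\<dots> = bilin p q M (\<lambda>i. cnj (?z i)) (vec_index x)"
    unfolding bilin_def mult.assoc sum_distrib_left[symmetric] ..
  finally have "cmod (bilin p q M (\<lambda>i. cnj (?z i)) (vec_index x)) = cmod (complex_of_real ((vnorm p ?z)\<^sup>2))"
    by (rule arg_cong[OF sym])
  then have "(vnorm p ?z)\<^sup>2 = cmod (bilin p q M (\<lambda>i. cnj (?z i)) (vec_index x))"
    unfolding norm_of_real by simp
  also have "\<dots> \<le> w * (vnorm p (\<lambda>i. cnj (?z i)) * vnorm q (vec_index x))"
    using assms unfolding norm_bound_def by blast
  also have "\<dots> \<le> w * (vnorm p ?z * 1)"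
    unfolding vnorm_cnj using assms x(2) by (intro mult_left_mono) (auto simp: norm_bound_def)
  finally have le: "vnorm p ?z * vnorm p ?z \<le> w * vnorm p ?z" by (simp add: power2_eq_square)
  have "vnorm p ?z \<le> w"
  proof (cases "vnorm p ?z = 0")
    case True
    then show ?thesis using assms by (simp add: norm_bound_def)
  next
    case False
    then have "0 < vnorm p ?z" using vnorm_nonneg[of p ?z] by linarith
    with le show ?thesis by (rule mult_right_le_imp_le)
  qed
  then show "euclidean_norm (?N *\<^sub>v x) \<le> w" using norm by simp
qed


section \<open>Diagonal sampling matrices\<close>

text \<open>An a.e. continuous function may be unbounded, but only near its discontinuities: the sets
  \<open>U k\<close> of the points within distance \<open>1/(k+1)\<close> of a value larger than \<open>k\<close> decrease to a null
  set, and for \<open>n > k\<close> each sampling point with a value larger than \<open>k\<close> contributes a whole grid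
  cell to \<open>U k\<close>.\<close>

lemma few_large_samples:
  fixes a :: "real \<Rightarrow> complex"
  assumes cont: "AE x in lebesgue_on {0..1}. continuous (at x within {0..1}) a" and "0 < \<epsilon>"
  obtains k :: nat where
    "\<And>n. k < n \<Longrightarrow> real (card {i. i < n \<and> real k < cmod (a (real (i + 1) / real n))}) \<le> \<epsilon> * real n"
proof -
  let ?M = "lebesgue_on {0..1::real}"
  interpret finite_measure ?M by (rule finite_measure_lebesgue_on) simp
  \<comment> \<open>A union of open balls, so \<open>U k\<close> is measurable whatever the set of
    large values looks like.\<close>
  define V where "V k = (\<Union>y\<in>{y \<in> {0..1}. real k < cmod (a y)}. ball y (1 / real (k + 1)))" for k
  define U where "U k = {0..1} \<inter> V k" for k :: nat
  have U_iff: "x \<in> U k \<longleftrightarrow> x \<in> {0..1} \<and> (\<exists>y\<in>{0..1}. real k < cmod (a y) \<and> dist y x < 1 / real (k + 1))"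
    for x k by (auto simp: U_def V_def)
  have "open (V k)" for k unfolding V_def by (intro open_UN ballI open_ball)
  then have U_sets: "U k \<in> sets ?M" for k
    unfolding U_def sets_restrict_space by (intro imageI) (auto intro: borel_open)
  have "decseq U"
  proof (rule decseq_SucI, rule subsetI)
    fix k x assume "x \<in> U (Suc k)"
    then obtain y where y: "x \<in> {0..1}" "y \<in> {0..1}" "real (Suc k) < cmod (a y)"
      "dist y x < 1 / real (Suc k + 1)" unfolding U_iff by blast
    have "1 / real (Suc k + 1) \<le> 1 / real (k + 1)" by (intro divide_left_mono) auto
    with y show "x \<in> U k" unfolding U_iff by (intro conjI bexI[of _ y]) auto
  qed
  then have lim: "(\<lambda>k. measure ?M (U k)) \<longlonglongrightarrow> measure ?M (\<Inter>k. U k)"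
    using U_sets by (intro finite_Lim_measure_decseq) auto
  have "AE x in ?M. x \<in> (\<Inter>k. U k) \<longrightarrow> x \<in> {}"
    using cont
  proof eventually_elim
    case (elim x)
    from elim[unfolded continuous_within_eps_delta, rule_format, of 1]
    obtain e where e: "0 < e" "\<And>y. y \<in> {0..1} \<Longrightarrow> dist y x < e \<Longrightarrow> dist (a y) (a x) < 1"
      by auto
    \<comment> \<open>Large enough for two purposes: the radius \<open>1 / (k + 1)\<close> falls
      below \<open>e\<close>, and \<open>k\<close> exceeds every value that \<open>a\<close> takes
      within distance \<open>e\<close> of \<open>x\<close>.\<close>
    obtain k where k: "cmod (a x) + 1 + 1 / e < real k" using reals_Archimedean2 by blast
    have "x \<notin> U k"
    proof
      assume "x \<in> U k"
      then obtain y where y: "y \<in> {0..1}" "real k < cmod (a y)" "dist y x < 1 / real (k + 1)"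
        unfolding U_iff by blast
      have "1 / e < real (k + 1)" using k norm_ge_zero[of "a x"] by linarith
      then have "1 / real (k + 1) < e" using e(1) by (simp add: field_simps)
      then have "dist (a y) (a x) < 1" using e(2) y by simp
      then have "cmod (a y) < cmod (a x) + 1"
        using norm_triangle_ineq2[of "a y" "a x"] by (simp add: dist_norm)
      moreover have "0 < 1 / e" using e(1) by simp
      ultimately show False using y(2) k by linarith
    qed
    then show ?case by blast
  qed
  then have "measure ?M (\<Inter>k. U k) \<le> measure ?M {}" by (rule finite_measure_mono_AE) simp
  then have "measure ?M (\<Inter>k. U k) = 0" by (simp add: measure_le_0_iff)
  with lim have "\<forall>\<^sub>F k in sequentially. measure ?M (U k) < \<epsilon>"
    using \<open>0 < \<epsilon>\<close> by (simp add: order_tendstoD(2))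
  then obtain k where k: "measure ?M (U k) < \<epsilon>"
    using eventually_happens trivial_limit_sequentially by blast
  have "real (card {i. i < n \<and> real k < cmod (a (real (i + 1) / real n))}) \<le> \<epsilon> * real n" if "k < n" for n
  proof -
    let ?J = "{i. i < n \<and> real k < cmod (a (real (i + 1) / real n))}"
    \<comment> \<open>The grid cell ending at the sampling point \<open>(i + 1) / n\<close>; its
      length \<open>1 / n\<close> is at most the radius of the ball around that point, since
      \<open>k < n\<close>.\<close>
    define C where "C i = {real i / real n<..<real (i + 1) / real n}" for i
    have n: "0 < real n" using that by simp
    have C01: "C i \<subseteq> {0..1}" if "i \<in> ?J" for i
    proof
      fix x assume x: "x \<in> C i"
      have "0 \<le> real i / real n" by simp
      moreover have "real (i + 1) / real n \<le> 1" using that n by (simp add: field_simps)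
      ultimately show "x \<in> {0..1}"
        using x unfolding C_def greaterThanLessThan_iff atLeastAtMost_iff by linarith
    qed
    have CU: "C i \<subseteq> U k" if "i \<in> ?J" for i
    proof
      fix x assume x: "x \<in> C i"
      have "real (i + 1) / real n - real i / real n = 1 / real n"
        by (simp add: diff_divide_distrib[symmetric])
      then have "dist (real (i + 1) / real n) x < 1 / real n" using x by (auto simp: C_def dist_real_def)
      also have "1 / real n \<le> 1 / real (k + 1)" using \<open>k < n\<close> by (intro divide_left_mono) auto
      finally have "dist (real (i + 1) / real n) x < 1 / real (k + 1)" .
      moreover have "real (i + 1) / real n \<in> {0..1}" using that n by (simp add: field_simps)
      ultimately show "x \<in> U k" unfolding U_iff using that x C01[OF that] by blast
    qed
    have C_sets: "C i \<in> sets ?M" if "i \<in> ?J" for i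
      using C01[OF that] by (auto simp: sets_restrict_space_iff C_def)
    have Ioo: "measure lebesgue {l<..<u} = u - l" if "l \<le> u" for l u :: real
      using that by simp
    have "disjoint_family_on C ?J"
      unfolding disjoint_family_on_def
    proof (intro ballI impI)
      fix i j :: nat assume "i \<noteq> j"
      then have "real (i + 1) \<le> real j \<or> real (j + 1) \<le> real i" by linarith
      then show "C i \<inter> C j = {}"
      proof
        assume "real (i + 1) \<le> real j"
        then have "real (i + 1) / real n \<le> real j / real n" by (rule divide_right_mono) simp
        then show ?thesis unfolding C_def by auto
      next
        assume "real (j + 1) \<le> real i"
        then have "real (j + 1) / real n \<le> real i / real n" by (rule divide_right_mono) simp
        then show ?thesis unfolding C_def by auto
      qed
    qed
    then have "measure ?M (\<Union>i\<in>?J. C i) = (\<Sum>i\<in>?J. measure ?M (C i))"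
      using C_sets by (intro finite_measure_finite_Union) auto
    also have "\<dots> = (\<Sum>i\<in>?J. 1 / real n)"
    proof (rule sum.cong[OF refl])
      fix i assume i: "i \<in> ?J"
      have "measure ?M (C i) = measure lebesgue (C i)"
        using C01[OF i] by (intro measure_restrict_space) auto
      also have "\<dots> = real (i + 1) / real n - real i / real n"
        unfolding C_def by (rule Ioo) (simp add: divide_right_mono)
      also have "\<dots> = 1 / real n" by (simp add: diff_divide_distrib[symmetric])
      finally show "measure ?M (C i) = 1 / real n" .
    qed
    finally have "real (card ?J) / real n = measure ?M (\<Union>i\<in>?J. C i)" by simp
    also have "\<dots> \<le> measure ?M (U k)" using CU U_sets by (intro finite_measure_mono) auto
    finally have "real (card ?J) / real n \<le> \<epsilon>" using k by simp
    then show ?thesis using n by (simp add: field_simps)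
  qed
  then show ?thesis using that by blast
qed

text \<open>The low rank plus small norm description of zero-distributed sequences, made uniform
  over all lists of the given length, since the partition changes with \<open>n\<close>.\<close>

definition vanishing :: "nat \<Rightarrow> nat \<Rightarrow> nat \<Rightarrow> (nat list \<Rightarrow> nat \<Rightarrow> nat \<Rightarrow> complex) \<Rightarrow> bool" where
  "vanishing \<nu> s t Z \<longleftrightarrow>
     (\<forall>\<epsilon>>0. \<exists>m0. \<forall>ms. length ms = \<nu> \<longrightarrow> m0 \<le> sum_list ms \<longrightarrow>
        splits (sum_list ms * s) (sum_list ms * t) (Z ms) (\<epsilon> * real (sum_list ms)) \<epsilon>)"

lemma vanishingD:
  assumes "vanishing \<nu> s t Z" "0 < \<epsilon>"
  obtains m0 where "\<And>ms. length ms = \<nu> \<Longrightarrow> m0 \<le> sum_list ms \<Longrightarrow>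
    splits (sum_list ms * s) (sum_list ms * t) (Z ms) (\<epsilon> * real (sum_list ms)) \<epsilon>"
  using assms unfolding vanishing_def by blast

lemma vanishing_cong:
  assumes "vanishing \<nu> s t Z"
    "\<And>ms k l. length ms = \<nu> \<Longrightarrow> k < sum_list ms * s \<Longrightarrow> l < sum_list ms * t \<Longrightarrow> Y ms k l = Z ms k l"
  shows "vanishing \<nu> s t Y"
  unfolding vanishing_def
proof (intro allI impI)
  fix \<epsilon> :: real assume "0 < \<epsilon>"
  then obtain m0 where m0: "\<And>ms. length ms = \<nu> \<Longrightarrow> m0 \<le> sum_list ms \<Longrightarrow>
    splits (sum_list ms * s) (sum_list ms * t) (Z ms) (\<epsilon> * real (sum_list ms)) \<epsilon>"
    using vanishingD[OF assms(1)] by blast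
  show "\<exists>m0. \<forall>ms. length ms = \<nu> \<longrightarrow> m0 \<le> sum_list ms \<longrightarrow>
        splits (sum_list ms * s) (sum_list ms * t) (Y ms) (\<epsilon> * real (sum_list ms)) \<epsilon>"
    by (intro exI[of _ m0] allI impI splits_cong[OF m0] assms(2))
qed

lemma vanishing_sum:
  assumes "finite S" "\<And>a. a \<in> S \<Longrightarrow> vanishing \<nu> s t (Z a)"
  shows "vanishing \<nu> s t (\<lambda>ms k l. \<Sum>a\<in>S. Z a ms k l)"
  unfolding vanishing_def
proof (intro allI impI)
  fix \<epsilon> :: real assume "0 < \<epsilon>"
  \<comment> \<open>The \<open>+ 1\<close> keeps the divisor positive for empty
    \<open>S\<close>.\<close>
  let ?c = "real (card S + 1)"
  have "\<forall>a\<in>S. \<exists>m0. \<forall>ms. length ms = \<nu> \<longrightarrow> m0 \<le> sum_list ms \<longrightarrow>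
      splits (sum_list ms * s) (sum_list ms * t) (Z a ms) (\<epsilon> / ?c * real (sum_list ms)) (\<epsilon> / ?c)"
  proof
    fix a assume "a \<in> S"
    then show "\<exists>m0. \<forall>ms. length ms = \<nu> \<longrightarrow> m0 \<le> sum_list ms \<longrightarrow>
      splits (sum_list ms * s) (sum_list ms * t) (Z a ms) (\<epsilon> / ?c * real (sum_list ms)) (\<epsilon> / ?c)"
    proof -
      have "0 < \<epsilon> / ?c" using \<open>0 < \<epsilon>\<close> by simp
      with vanishingD[OF assms(2)[OF \<open>a \<in> S\<close>] this] show ?thesis by blast
    qed
  qed
  then obtain m0 where m0: "\<And>a ms. a \<in> S \<Longrightarrow> length ms = \<nu> \<Longrightarrow> m0 a \<le> sum_list ms \<Longrightarrow>
      splits (sum_list ms * s) (sum_list ms * t) (Z a ms) (\<epsilon> / ?c * real (sum_list ms)) (\<epsilon> / ?c)"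
    unfolding bchoice_iff by blast
  show "\<exists>m0. \<forall>ms. length ms = \<nu> \<longrightarrow> m0 \<le> sum_list ms \<longrightarrow>
      splits (sum_list ms * s) (sum_list ms * t) (\<lambda>k l. \<Sum>a\<in>S. Z a ms k l) (\<epsilon> * real (sum_list ms)) \<epsilon>"
  proof (intro exI[of _ "\<Sum>a\<in>S. m0 a"] allI impI)
    fix ms :: "nat list" assume ms: "length ms = \<nu>" "(\<Sum>a\<in>S. m0 a) \<le> sum_list ms"
    have "m0 a \<le> sum_list ms" if "a \<in> S" for a
      using member_le_sum[OF that, of m0] assms(1) ms(2) by simp
    then have split: "splits (sum_list ms * s) (sum_list ms * t) (\<lambda>k l. \<Sum>a\<in>S. Z a ms k l)
        (real (card S) * (\<epsilon> / ?c * real (sum_list ms))) (real (card S) * (\<epsilon> / ?c))"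
      using ms(1) assms(1) by (intro splits_sum m0)
    have le: "real (card S) * (\<epsilon> / ?c) \<le> \<epsilon>" using \<open>0 < \<epsilon>\<close> by (simp add: field_simps)
    have "real (card S) * (\<epsilon> / ?c * real (sum_list ms)) \<le> \<epsilon> * real (sum_list ms)"
      using mult_right_mono[OF le, of "real (sum_list ms)"] by (simp only: mult.assoc of_nat_0_le_iff)
    from splits_mono[OF split this le] show "splits (sum_list ms * s) (sum_list ms * t) (\<lambda>k l. \<Sum>a\<in>S. Z a ms k l)
        (\<epsilon> * real (sum_list ms)) \<epsilon>" .
  qed
qed

lemma card_div_less:
  assumes "finite J"
  shows "card {k. k < n * s \<and> k div s \<in> J} \<le> s * card J"
proof (cases "s = 0")
  case False
  have "{k. k < n * s \<and> k div s \<in> J} \<subseteq> (\<lambda>(i, r). i * s + r) ` (J \<times> {..<s})"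
  proof
    fix k assume "k \<in> {k. k < n * s \<and> k div s \<in> J}"
    then show "k \<in> (\<lambda>(i, r). i * s + r) ` (J \<times> {..<s})"
      using False by (intro image_eqI[of _ _ "(k div s, k mod s)"]) auto
  qed
  then have "card {k. k < n * s \<and> k div s \<in> J} \<le> card ((\<lambda>(i, r). i * s + r) ` (J \<times> {..<s}))"
    using assms by (intro card_mono) auto
  also have "\<dots> \<le> card (J \<times> {..<s})" using assms by (intro card_image_le) auto
  finally show ?thesis by (simp add: card_cartesian_product mult.commute)
qed auto

text \<open>The few rows with a large sampled value go into the low rank part; on all others the
  multiplication enlarges the norm at most by the level \<open>b\<close>, which is compensated
  beforehand.\<close>

lemma vanishing_sampling:
  fixes a :: "real \<Rightarrow> complex"
  assumes cont: "AE x in lebesgue_on {0..1}. continuous (at x within {0..1}) a"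
    and Z: "vanishing \<nu> s t Z" and "0 < s"
  shows "vanishing \<nu> s t (\<lambda>ms k l. a (real (k div s + 1) / real (sum_list ms)) * Z ms k l)"
  unfolding vanishing_def
proof (intro allI impI)
  fix \<epsilon> :: real assume "0 < \<epsilon>"
  \<comment> \<open>Every sample governs \<open>s\<close> rows, hence the division by
    \<open>s\<close>; the 2 reserves half of the rank for the remaining rows.\<close>
  obtain b :: nat where b: "\<And>n. b < n \<Longrightarrow>
      real (card {i. i < n \<and> real b < cmod (a (real (i + 1) / real n))}) \<le> \<epsilon> / (2 * real s) * real n"
    using few_large_samples[OF cont, of "\<epsilon> / (2 * real s)"] \<open>0 < \<epsilon>\<close> \<open>0 < s\<close> by auto
  \<comment> \<open>\<open>b\<close> depends only on \<open>a\<close> and \<epsilon>, so the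
    tolerance for \<open>Z\<close> can still be chosen after it. The \<open>+ 1\<close> covers
    \<open>b = 0\<close>.\<close>
  define \<epsilon>' where "\<epsilon>' = \<epsilon> / (2 * real (b + 1))"
  have "0 < \<epsilon>'" using \<open>0 < \<epsilon>\<close> by (simp add: \<epsilon>'_def)
  then obtain m0 where m0: "\<And>ms. length ms = \<nu> \<Longrightarrow> m0 \<le> sum_list ms \<Longrightarrow>
    splits (sum_list ms * s) (sum_list ms * t) (Z ms) (\<epsilon>' * real (sum_list ms)) \<epsilon>'"
    using vanishingD[OF Z] by blast
  show "\<exists>m0. \<forall>ms. length ms = \<nu> \<longrightarrow> m0 \<le> sum_list ms \<longrightarrow>
      splits (sum_list ms * s) (sum_list ms * t)
        (\<lambda>k l. a (real (k div s + 1) / real (sum_list ms)) * Z ms k l) (\<epsilon> * real (sum_list ms)) \<epsilon>"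
  proof (intro exI[of _ "max m0 (Suc b)"] allI impI)
    fix ms :: "nat list" assume ms: "length ms = \<nu>" "max m0 (Suc b) \<le> sum_list ms"
    let ?n = "sum_list ms"
    define \<alpha> where "\<alpha> k = a (real (k div s + 1) / real ?n)" for k
    let ?J = "{i. i < ?n \<and> real b < cmod (a (real (i + 1) / real ?n))}"
    let ?K = "{k. k < ?n * s \<and> k div s \<in> ?J}"
    have "rank_bound (?n * s) (?n * t) (\<lambda>k l. if k \<in> ?K then \<alpha> k * Z ms k l else 0) (real (card ?K))"
      by (rule rank_bound_rows) auto
    moreover have "real (card ?K) \<le> \<epsilon> * real ?n / 2"
    proof -
      have "real (card ?K) \<le> real (s * card ?J)" by (intro of_nat_mono card_div_less) simp
      also have "\<dots> \<le> real s * (\<epsilon> / (2 * real s) * real ?n)"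
        unfolding of_nat_mult using ms by (intro mult_left_mono b) auto
      also have "\<dots> = \<epsilon> * real ?n / 2" using \<open>0 < s\<close> by simp
      finally show ?thesis .
    qed
    ultimately have "rank_bound (?n * s) (?n * t) (\<lambda>k l. if k \<in> ?K then \<alpha> k * Z ms k l else 0) (\<epsilon> * real ?n / 2)"
      by (rule rank_bound_mono)
    then have 1: "splits (?n * s) (?n * t) (\<lambda>k l. if k \<in> ?K then \<alpha> k * Z ms k l else 0) (\<epsilon> * real ?n / 2) 0"
      by (rule splitsI) (auto intro: norm_bound_zero)
    have "splits (?n * s) (?n * t) (Z ms) (\<epsilon>' * real ?n) \<epsilon>'" using ms by (intro m0) auto
    then have "splits (?n * s) (?n * t) (\<lambda>k l. (if k \<in> ?K then 0 else \<alpha> k) * 1 * Z ms (id k) (id l))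
        (\<epsilon>' * real ?n) (\<epsilon>' * real b)"
      by (rule splits_pullback)
        (use \<open>0 < s\<close> in \<open>auto simp: \<alpha>_def not_less less_mult_imp_div_less mult.commute\<close>)
    then have 2: "splits (?n * s) (?n * t) (\<lambda>k l. if k \<in> ?K then 0 else \<alpha> k * Z ms k l) (\<epsilon>' * real ?n) (\<epsilon>' * real b)"
      by (rule splits_cong) auto
    have "\<epsilon>' * real b \<le> \<epsilon>" "\<epsilon>' \<le> \<epsilon> / 2" using \<open>0 < \<epsilon>\<close> by (simp_all add: \<epsilon>'_def field_simps)
    moreover from this(2) have "\<epsilon>' * real ?n \<le> \<epsilon> / 2 * real ?n" by (rule mult_right_mono) simp
    ultimately have "splits (?n * s) (?n * t) (\<lambda>k l. (if k \<in> ?K then \<alpha> k * Z ms k l else 0) +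
        (if k \<in> ?K then 0 else \<alpha> k * Z ms k l)) (\<epsilon> * real ?n) \<epsilon>"
      by (intro splits_mono[OF splits_add[OF 1 2]]) auto
    then show "splits (?n * s) (?n * t) (\<lambda>k l. a (real (k div s + 1) / real ?n) * Z ms k l) (\<epsilon> * real ?n) \<epsilon>"
      by (rule splits_cong) (simp add: \<alpha>_def)
  qed
qed


section \<open>Block triangular truncation\<close>

definition part_end :: "nat list \<Rightarrow> nat \<Rightarrow> nat" where
  "part_end ms p = sum_list (take (Suc p) ms)"

text \<open>All kept blocks in block row \<open>p\<close> are merged into one product of coordinate
  projections around \<open>X\<close>, so there is one summand per part instead of one per pair of
  parts.\<close>

definition lower_part :: "nat \<Rightarrow> nat \<Rightarrow> nat list \<Rightarrow> (nat \<Rightarrow> nat \<Rightarrow> complex) \<Rightarrow> nat \<Rightarrow> nat \<Rightarrow> complex" where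
  "lower_part s t ms X k l = (\<Sum>p<length ms.
     of_bool (k div s \<in> part_range ms p) * of_bool (l div t < part_end ms p) * X k l)"

definition upper_part :: "nat \<Rightarrow> nat \<Rightarrow> nat list \<Rightarrow> (nat \<Rightarrow> nat \<Rightarrow> complex) \<Rightarrow> nat \<Rightarrow> nat \<Rightarrow> complex" where
  "upper_part s t ms X k l = (\<Sum>p<length ms.
     of_bool (k div s \<in> part_range ms p) * of_bool (part_end ms p \<le> l div t) * X k l)"

lemma part_range_exists:
  assumes "j < sum_list (take n ms)" "n \<le> length ms"
  shows "\<exists>q<n. j \<in> part_range ms q"
  using assms
proof (induction n)
  case (Suc n)
  show ?case
  proof (cases "j < sum_list (take n ms)")
    case True
    then obtain q where "q < n" "j \<in> part_range ms q" using Suc by auto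
    then show ?thesis by (intro exI[of _ q]) simp
  next
    case False
    then have "j \<in> part_range ms n" using Suc.prems(1) by (simp add: part_range_def)
    then show ?thesis by blast
  qed
qed simp

lemma part_range_less_part_end:
  assumes "j \<in> part_range ms q" "q \<le> p"
  shows "j < part_end ms p"
proof -
  have "take (Suc p) ms = take (Suc q) ms @ take (p - q) (drop (Suc q) ms)"
    using assms(2) by (metis Suc_le_mono diff_Suc_Suc le_add_diff_inverse take_add)
  then have "sum_list (take (Suc q) ms) \<le> part_end ms p" by (simp add: part_end_def)
  then show ?thesis using assms(1) by (simp add: part_range_def)
qed

lemma part_sum:
  assumes "i \<in> part_range ms p" "p < length ms"
  shows "(\<Sum>q<length ms. of_bool (i \<in> part_range ms q) * f q) = (f p :: complex)"
proof -
  have "(\<Sum>q<length ms. of_bool (i \<in> part_range ms q) * f q) = (\<Sum>q<length ms. if q = p then f q else 0)"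
    using assms(1) part_range_unique by (intro sum.cong) auto
  then show ?thesis using assms(2) by simp
qed

lemma lower_add_upper:
  assumes "k < sum_list ms * s"
  shows "lower_part s t ms X k l + upper_part s t ms X k l = X k l"
proof -
  have "k div s < sum_list (take (length ms) ms)" using assms by (simp add: less_mult_imp_div_less)
  then obtain p where p: "p < length ms" "k div s \<in> part_range ms p"
    using part_range_exists[of "k div s" "length ms" ms] by auto
  show ?thesis
    unfolding lower_part_def upper_part_def mult.assoc part_sum[OF p(2,1)] by auto
qed

lemma blocktril_lower_part:
  assumes "k < sum_list ms * s" "l < sum_list ms * t"
  shows "blocktril s t ms A $$ (k, l) = lower_part s t ms (\<lambda>k l. A $$ (k, l)) k l"
proof -
  have "0 < s" "0 < t" using assms by (auto intro: gr0I)
  have "k div s < sum_list (take (length ms) ms)" using assms(1) by (simp add: less_mult_imp_div_less)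
  then obtain p where p: "p < length ms" "k div s \<in> part_range ms p"
    using part_range_exists[of "k div s" "length ms" ms] by auto
  \<comment> \<open>The parts tile the indices, so a column belongs to a part not after
    \<open>p\<close> exactly when it lies before the end of part \<open>p\<close>.\<close>
  have "(\<exists>p' q. q \<le> p' \<and> p' < length ms \<and> k div s \<in> part_range ms p' \<and> l div t \<in> part_range ms q)
      \<longleftrightarrow> l div t < part_end ms p"
  proof
    assume "\<exists>p' q. q \<le> p' \<and> p' < length ms \<and> k div s \<in> part_range ms p' \<and> l div t \<in> part_range ms q"
    then show "l div t < part_end ms p"
      using part_range_unique[OF p(2)] part_range_less_part_end by blast
  next
    assume "l div t < part_end ms p"
    then obtain q where "q < Suc p" "l div t \<in> part_range ms q"
      using part_range_exists[of "l div t" "Suc p" ms] p(1) unfolding part_end_def by auto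
    then show "\<exists>p' q. q \<le> p' \<and> p' < length ms \<and> k div s \<in> part_range ms p' \<and> l div t \<in> part_range ms q"
      using p by (intro exI[of _ p] exI[of _ q]) auto
  qed
  then show ?thesis
    using assms \<open>0 < s\<close> \<open>0 < t\<close>
    unfolding lower_part_def mult.assoc part_sum[OF p(2,1)] blocktril_def block_matrix_def block_of_def
    by simp
qed

lemma rank_bound_lower_part:
  assumes "rank_bound p q X r"
  shows "rank_bound p q (lower_part s t ms X) (real (length ms) * r)"
proof -
  have "rank_bound p q (\<lambda>k l. of_bool (k div s \<in> part_range ms i) * of_bool (l div t < part_end ms i) * X (id k) (id l)) r"
    for i using assms by (rule rank_bound_pullback) auto
  then have "rank_bound p q (\<lambda>k l. \<Sum>i<length ms. of_bool (k div s \<in> part_range ms i) *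
      of_bool (l div t < part_end ms i) * X (id k) (id l)) (real (card {..<length ms}) * r)"
    by (intro rank_bound_sum) auto
  then show ?thesis by (simp add: lower_part_def[abs_def])
qed

lemma norm_bound_lower_part:
  assumes "norm_bound p q X w"
  shows "norm_bound p q (lower_part s t ms X) (real (length ms) * w)"
proof -
  have "norm_bound p q (\<lambda>k l. of_bool (k div s \<in> part_range ms i) * of_bool (l div t < part_end ms i) * X (id k) (id l)) (w * 1)"
    for i using assms by (rule norm_bound_pullback) auto
  then have "norm_bound p q (\<lambda>k l. \<Sum>i<length ms. of_bool (k div s \<in> part_range ms i) *
      of_bool (l div t < part_end ms i) * X (id k) (id l)) (real (card {..<length ms}) * (w * 1))"
    by (intro norm_bound_sum) auto
  then show ?thesis by (simp add: lower_part_def[abs_def])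
qed

section \<open>Discarded parts of the approximating sums\<close>

lemma toeplitz_matrix_index:
  assumes "k < m * s" "l < m * t"
  shows "toeplitz_matrix m s t f $$ (k, l) =
    fcoeff (\<lambda>\<theta>. f \<theta> $$ (k mod s, l mod t)) (int (k div s) - int (l div t))"
proof -
  have "0 < s" "0 < t" using assms by (auto intro: gr0I)
  then show ?thesis using assms
    by (simp add: toeplitz_matrix_def block_matrix_def fourier_coeff_def fcoeff_def)
qed

lemma sampling_mult_index:
  assumes "X \<in> carrier_mat (m * s) q" "k < m * s" "l < q"
  shows "(diagonal_sampling_matrix m s s (\<lambda>x. a x \<cdot>\<^sub>m 1\<^sub>m s) * X) $$ (k, l)
    = a (real (k div s + 1) / real m) * X $$ (k, l)"
proof -
  let ?D = "diagonal_sampling_matrix m s s (\<lambda>x. a x \<cdot>\<^sub>m 1\<^sub>m s)"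
  have "0 < s" using assms(2) by (auto intro: gr0I)
  have D: "?D $$ (k, r) = (if r = k then a (real (k div s + 1) / real m) else 0)" if "r < m * s" for r
  proof -
    have "k div s = r div s \<and> k mod s = r mod s \<longleftrightarrow> r = k" by (metis div_mult_mod_eq)
    then show ?thesis using \<open>0 < s\<close> that assms(2)
      by (auto simp: diagonal_sampling_matrix_def block_matrix_def)
  qed
  have "?D \<in> carrier_mat (m * s) (m * s)" by (simp add: diagonal_sampling_matrix_def block_matrix_def)
  then have "(?D * X) $$ (k, l) = (\<Sum>r<m * s. ?D $$ (k, r) * X $$ (r, l))"
    using assms by (auto simp: scalar_prod_def atLeast0LessThan)
  also have "\<dots> = (\<Sum>r<m * s. if r = k then a (real (k div s + 1) / real m) * X $$ (k, l) else 0)"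
    by (intro sum.cong refl) (simp add: D)
  finally show ?thesis using assms(2) by simp
qed

text \<open>Handles one part and one position \<open>(u, v)\<close> inside the blocks. Among indices
  with a fixed remainder modulo \<open>s\<close>, division by \<open>s\<close> is injective, so the
  scalar corner is embedded without loss in rank or norm.\<close>

lemma vanishing_corner:
  assumes f: "integrable period f"
  shows "vanishing \<nu> s t (\<lambda>ms k l. of_bool (k div s \<in> part_range ms p \<and> k mod s = u) *
    of_bool (l mod t = v) * corner (part_end ms p) f (k div s) (l div t))"
  unfolding vanishing_def
proof (intro allI impI)
  fix \<epsilon> :: real assume "0 < \<epsilon>"
  then obtain m0 where m0: "\<And>m c. m \<ge> m0 \<Longrightarrow> splits m m (corner c f) (\<epsilon> * real m) \<epsilon>"
    using splits_corner[OF f] by blast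
  have inj: "inj_on (\<lambda>k. k div r) K" if "\<And>k. k \<in> K \<Longrightarrow> k mod r = w" for r w :: nat and K
  proof (rule inj_onI)
    fix k l assume "k \<in> K" "l \<in> K" "k div r = l div r"
    then show "k = l" using that div_mult_mod_eq[of k r] div_mult_mod_eq[of l r] by simp
  qed
  show "\<exists>m0. \<forall>ms. length ms = \<nu> \<longrightarrow> m0 \<le> sum_list ms \<longrightarrow>
      splits (sum_list ms * s) (sum_list ms * t) (\<lambda>k l. of_bool (k div s \<in> part_range ms p \<and> k mod s = u) *
        of_bool (l mod t = v) * corner (part_end ms p) f (k div s) (l div t)) (\<epsilon> * real (sum_list ms)) \<epsilon>"
  proof (intro exI[of _ m0] allI impI)
    fix ms :: "nat list" assume "m0 \<le> sum_list ms"
    then have "splits (sum_list ms) (sum_list ms) (corner (part_end ms p) f) (\<epsilon> * real (sum_list ms)) \<epsilon>"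
      by (rule m0)
    then have "splits (sum_list ms * s) (sum_list ms * t) (\<lambda>k l. of_bool (k div s \<in> part_range ms p \<and> k mod s = u) *
        of_bool (l mod t = v) * corner (part_end ms p) f (k div s) (l div t)) (\<epsilon> * real (sum_list ms)) (\<epsilon> * 1)"
    proof (rule splits_pullback)
      show "inj_on (\<lambda>k. k div s) {k. k < sum_list ms * s \<and>
          (of_bool (k div s \<in> part_range ms p \<and> k mod s = u) :: complex) \<noteq> 0}"
        by (rule inj[of _ _ u]) auto
      show "inj_on (\<lambda>l. l div t) {l. l < sum_list ms * t \<and> (of_bool (l mod t = v) :: complex) \<noteq> 0}"
        by (rule inj[of _ _ v]) auto
    qed (auto simp: less_mult_imp_div_less)
    then show "splits (sum_list ms * s) (sum_list ms * t) (\<lambda>k l. of_bool (k div s \<in> part_range ms p \<and> k mod s = u) *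
        of_bool (l mod t = v) * corner (part_end ms p) f (k div s) (l div t)) (\<epsilon> * real (sum_list ms)) \<epsilon>"
      by simp
  qed
qed

lemma sum_of_bool_entry:
  fixes F :: "nat \<Rightarrow> nat \<Rightarrow> complex"
  assumes "a < s" "b < t"
  shows "(\<Sum>u<s. \<Sum>v<t. of_bool (P \<and> a = u) * of_bool (b = v) * F u v) = of_bool P * F a b"
proof -
  have "(\<Sum>u<s. \<Sum>v<t. of_bool (P \<and> a = u) * of_bool (b = v) * F u v)
      = (\<Sum>u<s. if u = a then \<Sum>v<t. if v = b then of_bool P * F a b else 0 else 0)"
    by (intro sum.cong refl) (auto intro!: sum.cong)
  then show ?thesis using assms by simp
qed

text \<open>The discarded part is a sum of \<open>\<nu> * s * t\<close> scalar corners, one per part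
  and per entry of \<open>f\<close>; the number of summands is independent of the size.\<close>

lemma vanishing_toeplitz:
  assumes f: "matrix_L1_on {-pi..pi} s t f"
  shows "vanishing \<nu> s t (\<lambda>ms. upper_part s t ms (\<lambda>k l. toeplitz_matrix (sum_list ms) s t f $$ (k, l)))"
proof -
  let ?Z = "\<lambda>ms k l p u v. of_bool (k div s \<in> part_range ms p \<and> k mod s = u) *
    of_bool (l mod t = v) * corner (part_end ms p) (\<lambda>\<theta>. f \<theta> $$ (u, v)) (k div s) (l div t)"
  have "vanishing \<nu> s t (\<lambda>ms k l. \<Sum>p<\<nu>. \<Sum>u<s. \<Sum>v<t. ?Z ms k l p u v)"
    by (intro vanishing_sum finite_lessThan vanishing_corner) (use f in \<open>simp add: matrix_L1_on_def\<close>)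
  then show ?thesis
  proof (rule vanishing_cong)
    fix ms k l assume *: "length ms = \<nu>" "k < sum_list ms * s" "l < sum_list ms * t"
    then have "0 < s" "0 < t" by (auto intro: gr0I)
    show "upper_part s t ms (\<lambda>k l. toeplitz_matrix (sum_list ms) s t f $$ (k, l)) k l
        = (\<Sum>p<\<nu>. \<Sum>u<s. \<Sum>v<t. ?Z ms k l p u v)"
      unfolding upper_part_def *(1)
    proof (rule sum.cong[OF refl])
      fix p
      have "(\<Sum>u<s. \<Sum>v<t. ?Z ms k l p u v) = of_bool (k div s \<in> part_range ms p) *
          corner (part_end ms p) (\<lambda>\<theta>. f \<theta> $$ (k mod s, l mod t)) (k div s) (l div t)"
        by (rule sum_of_bool_entry) (use \<open>0 < s\<close> \<open>0 < t\<close> in auto)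
      \<comment> \<open>Rows of part \<open>p\<close> lie before its end, so the row condition in
        \<open>corner\<close> holds there.\<close>
      also have "\<dots> = of_bool (k div s \<in> part_range ms p) * of_bool (part_end ms p \<le> l div t) *
          toeplitz_matrix (sum_list ms) s t f $$ (k, l)"
        using part_range_less_part_end[of "k div s" ms p p] *
        by (simp add: corner_def toeplitz_matrix_index)
      finally show "of_bool (k div s \<in> part_range ms p) * of_bool (part_end ms p \<le> l div t) *
          toeplitz_matrix (sum_list ms) s t f $$ (k, l) = (\<Sum>u<s. \<Sum>v<t. ?Z ms k l p u v)" ..
    qed
  qed
qed

text \<open>Truncation acts entrywise and the sampling matrix multiplies rows by scalars, so the two
  commute and the sampled values can be taken out of \<open>upper_part\<close>.\<close>

lemma vanishing_upper_sampling_toeplitz: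
  fixes a :: "nat \<Rightarrow> real \<Rightarrow> complex"
  assumes "\<And>i. i \<in> S \<Longrightarrow> AE x in lebesgue_on {0..1}. continuous (at x within {0..1}) (a i)"
    and "\<And>i. i \<in> S \<Longrightarrow> matrix_L1_on {-pi..pi} s t (f i)" and "finite S" "0 < s"
  shows "vanishing \<nu> s t (\<lambda>ms. upper_part s t ms (\<lambda>k l.
    matrix_sum (sum_list ms * s) (sum_list ms * t)
      (\<lambda>i. diagonal_sampling_matrix (sum_list ms) s s (\<lambda>x. a i x \<cdot>\<^sub>m 1\<^sub>m s) *
        toeplitz_matrix (sum_list ms) s t (f i)) S $$ (k, l)))"
proof -
  let ?T = "\<lambda>ms i k l. toeplitz_matrix (sum_list ms) s t (f i) $$ (k, l)"
  have "vanishing \<nu> s t (\<lambda>ms k l. \<Sum>i\<in>S. a i (real (k div s + 1) / real (sum_list ms)) *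
      upper_part s t ms (?T ms i) k l)"
    by (intro vanishing_sum vanishing_sampling vanishing_toeplitz assms)
  then show ?thesis
  proof (rule vanishing_cong)
    fix ms k l assume *: "k < sum_list ms * s" "l < sum_list ms * t"
    have T: "toeplitz_matrix (sum_list ms) s t (f i) \<in> carrier_mat (sum_list ms * s) (sum_list ms * t)" for i
      by (simp add: toeplitz_matrix_def block_matrix_def)
    have "matrix_sum (sum_list ms * s) (sum_list ms * t)
        (\<lambda>i. diagonal_sampling_matrix (sum_list ms) s s (\<lambda>x. a i x \<cdot>\<^sub>m 1\<^sub>m s) *
          toeplitz_matrix (sum_list ms) s t (f i)) S $$ (k, l)
        = (\<Sum>i\<in>S. a i (real (k div s + 1) / real (sum_list ms)) * ?T ms i k l)"
      unfolding matrix_sum_def using * by (simp add: sampling_mult_index[OF T])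
    then show "upper_part s t ms (\<lambda>k l. matrix_sum (sum_list ms * s) (sum_list ms * t)
        (\<lambda>i. diagonal_sampling_matrix (sum_list ms) s s (\<lambda>x. a i x \<cdot>\<^sub>m 1\<^sub>m s) *
          toeplitz_matrix (sum_list ms) s t (f i)) S $$ (k, l)) k l
        = (\<Sum>i\<in>S. a i (real (k div s + 1) / real (sum_list ms)) * upper_part s t ms (?T ms i) k l)"
      unfolding upper_part_def
      by (simp only: sum_distrib_left) (subst sum.swap, simp only: mult_ac)
  qed
qed

text \<open>\<open>B\<close> itself is kept as the approximant: the truncation of \<open>X\<close>
  is \<open>B\<close>, minus the discarded part of \<open>B\<close>, plus the truncations of
  \<open>R\<close> and \<open>N\<close>.\<close>

lemma blocktril_perturbation:
  assumes X: "X = B + R + N" and B: "B \<in> carrier_mat (sum_list ms * s) (sum_list ms * t)"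
    and R: "R \<in> carrier_mat (sum_list ms * s) (sum_list ms * t)"
    and N: "N \<in> carrier_mat (sum_list ms * s) (sum_list ms * t)"
    and rank: "real (vec_space.rank (sum_list ms * s) R) \<le> r" and norm: "operator_norm N \<le> w"
    and upper: "splits (sum_list ms * s) (sum_list ms * t) (upper_part s t ms (\<lambda>k l. B $$ (k, l))) r' w'"
  shows "\<exists>R'\<in>carrier_mat (sum_list ms * s) (sum_list ms * t).
    \<exists>N'\<in>carrier_mat (sum_list ms * s) (sum_list ms * t).
      blocktril s t ms X = B + R' + N' \<and>
      real (vec_space.rank (sum_list ms * s) R') \<le> real (length ms) * r + r' \<and>
      operator_norm N' \<le> real (length ms) * w + w'"
proof -
  let ?p = "sum_list ms * s" and ?q = "sum_list ms * t"
  \<comment> \<open>The row weight \<open>- 1\<close> transfers the splitting to the negative of the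
    discarded part.\<close>
  obtain R1 N1 where 1: "rank_bound ?p ?q R1 r'" "norm_bound ?p ?q N1 w'"
    and eq: "\<And>k l. k < ?p \<Longrightarrow> l < ?q \<Longrightarrow> (- 1) * 1 * upper_part s t ms (\<lambda>k l. B $$ (k, l)) (id k) (id l) = R1 k l + N1 k l"
  proof -
    have "splits ?p ?q (\<lambda>k l. (- 1) * 1 * upper_part s t ms (\<lambda>k l. B $$ (k, l)) (id k) (id l)) r' (w' * 1)"
      by (rule splits_pullback[OF upper]) auto
    then show ?thesis using that by (auto elim: splitsE)
  qed
  let ?R = "\<lambda>k l. lower_part s t ms (\<lambda>k l. R $$ (k, l)) k l + R1 k l"
  let ?N = "\<lambda>k l. lower_part s t ms (\<lambda>k l. N $$ (k, l)) k l + N1 k l"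
  have "rank_bound ?p ?q ?R (real (length ms) * r + r')"
    by (intro rank_bound_add rank_bound_lower_part 1 rank_bound_mono[OF rank_bound_rank[OF R] rank])
  moreover have "norm_bound ?p ?q ?N (real (length ms) * w + w')"
    by (intro norm_bound_add norm_bound_lower_part 1 norm_bound_mono[OF norm_bound_operator_norm[OF N] norm])
  moreover have "blocktril s t ms X
      = B + Matrix.mat ?p ?q (\<lambda>(k, l). ?R k l) + Matrix.mat ?p ?q (\<lambda>(k, l). ?N k l)"
  proof (rule eq_matI)
    fix k l
    assume "k < dim_row (B + Matrix.mat ?p ?q (\<lambda>(k, l). ?R k l) + Matrix.mat ?p ?q (\<lambda>(k, l). ?N k l))"
      "l < dim_col (B + Matrix.mat ?p ?q (\<lambda>(k, l). ?R k l) + Matrix.mat ?p ?q (\<lambda>(k, l). ?N k l))"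
    then have kl: "k < ?p" "l < ?q" by auto
    have "lower_part s t ms (\<lambda>k l. X $$ (k, l)) k l = lower_part s t ms (\<lambda>k l. B $$ (k, l)) k l
        + lower_part s t ms (\<lambda>k l. R $$ (k, l)) k l + lower_part s t ms (\<lambda>k l. N $$ (k, l)) k l"
    proof -
      have "lower_part s t ms Y k l = (\<Sum>p<length ms. of_bool (k div s \<in> part_range ms p) *
          of_bool (l div t < part_end ms p)) * Y k l" for Y
        unfolding lower_part_def sum_distrib_right ..
      moreover have "X $$ (k, l) = B $$ (k, l) + R $$ (k, l) + N $$ (k, l)"
        using kl B R N by (simp add: X)
      ultimately show ?thesis by (simp only: distrib_left)
    qed
    moreover have "lower_part s t ms (\<lambda>k l. B $$ (k, l)) k l = B $$ (k, l) + R1 k l + N1 k l"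
    proof -
      have "lower_part s t ms (\<lambda>k l. B $$ (k, l)) k l = B $$ (k, l) - upper_part s t ms (\<lambda>k l. B $$ (k, l)) k l"
        by (rule add_implies_diff[OF lower_add_upper[OF kl(1)]])
      also have "\<dots> = B $$ (k, l) + (R1 k l + N1 k l)" unfolding eq[OF kl, symmetric] by simp
      finally show ?thesis by (simp only: add.assoc)
    qed
    ultimately show "blocktril s t ms X $$ (k, l)
        = (B + Matrix.mat ?p ?q (\<lambda>(k, l). ?R k l) + Matrix.mat ?p ?q (\<lambda>(k, l). ?N k l)) $$ (k, l)"
      using kl B by (simp add: blocktril_lower_part[OF kl])
  qed (auto simp: blocktril_def block_matrix_def)
  ultimately show ?thesis
    by (intro bexI[of _ "Matrix.mat ?p ?q (\<lambda>(k, l). ?R k l)"] bexI[of _ "Matrix.mat ?p ?q (\<lambda>(k, l). ?N k l)"])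
      (auto intro: rank_le_rank_bound operator_norm_le)
qed

section \<open>Assembling the approximating class\<close>

lemma to_infinity_alongD:
  assumes "to_infinity_along I d"
  shows "\<exists>n0. \<forall>n\<in>I. n0 \<le> n \<longrightarrow> m \<le> d n"
proof -
  have "\<forall>\<^sub>F n in inf sequentially (principal I). m \<le> d n"
    using assms unfolding to_infinity_along_def filterlim_at_top by blast
  then show ?thesis unfolding eventually_inf_principal eventually_sequentially by blast
qed

theorem theorem4p2:
  fixes \<nu> s t :: nat
    and I :: "nat set"
    and d :: "nat \<Rightarrow> nat"
    and ns :: "nat \<Rightarrow> nat list"
    and \<kappa> :: "real \<times> real \<Rightarrow> complex Matrix.mat"
    and A :: "nat \<Rightarrow> complex Matrix.mat"
  assumes "1 \<le> \<nu>" and "1 \<le> s" and "1 \<le> t"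
    and "infinite I"
    and "\<forall>n\<in>I. 0 < d n" and "to_infinity_along I d"
    and "\<forall>n\<in>I. length (ns n) = \<nu> \<and> is_partition (d n) (ns n)"
    and "matrix_measurable_on ({0..1} \<times> {-pi..pi}) s t \<kappa>"
    and "\<forall>n\<in>I. A n \<in> carrier_mat (d n * s) (d n * t)"
    and "GLT I s t d A \<kappa>"
  shows "GLT I s t d (\<lambda>n. blocktril s t (ns n) (A n)) \<kappa>"
proof -
  have ns: "length (ns n) = \<nu>" "sum_list (ns n) = d n" if "n \<in> I" for n
    using assms(7) that by (auto simp: is_partition_def)
  obtain N :: "nat \<Rightarrow> nat" and a :: "nat \<Rightarrow> nat \<Rightarrow> real \<Rightarrow> complex"
    and f :: "nat \<Rightarrow> nat \<Rightarrow> real \<Rightarrow> complex Matrix.mat" where af: "\<forall>m. \<forall>i\<in>{1..N m}.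
      (AE x in lebesgue_on {0..1}. continuous (at x within {0..1}) (a m i)) \<and>
      matrix_L1_on {-pi..pi} s t (f m i)"
    and lim: "AE (x, \<theta>) in lebesgue_on ({0..1} \<times> {-pi..pi}). \<forall>k<s. \<forall>l<t.
           (\<lambda>m. matrix_sum s t (\<lambda>i. a m i x \<cdot>\<^sub>m f m i \<theta>) {1..N m} $$ (k, l)) \<longlonglongrightarrow> \<kappa> (x, \<theta>) $$ (k, l)"
    and acs: "acs I (\<lambda>n. d n * s) (\<lambda>n. d n * t)
          (\<lambda>m n. matrix_sum (d n * s) (d n * t)
             (\<lambda>i. diagonal_sampling_matrix (d n) s s (\<lambda>x. a m i x \<cdot>\<^sub>m 1\<^sub>m s) *
                  toeplitz_matrix (d n) s t (f m i)) {1..N m}) A"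
    using assms(10) unfolding GLT_def by (elim conjE exE) (rule that, assumption+)
  define B where "B m n = matrix_sum (d n * s) (d n * t)
      (\<lambda>i. diagonal_sampling_matrix (d n) s s (\<lambda>x. a m i x \<cdot>\<^sub>m 1\<^sub>m s) *
        toeplitz_matrix (d n) s t (f m i)) {1..N m}" for m n
  have B: "B m n \<in> carrier_mat (d n * s) (d n * t)" for m n by (simp add: B_def matrix_sum_def)
  let ?p = "\<lambda>n. d n * s" and ?q = "\<lambda>n. d n * t"
  obtain n0 c \<omega> where c: "c \<longlonglongrightarrow> 0" and \<omega>: "\<omega> \<longlonglongrightarrow> 0" and
    split: "\<And>m n. n \<in> I \<Longrightarrow> n0 m \<le> n \<Longrightarrow> \<exists>R\<in>carrier_mat (?p n) (?q n). \<exists>N\<in>carrier_mat (?p n) (?q n).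
      A n = B m n + R + N \<and> real (vec_space.rank (?p n) R) \<le> c m * real (min (?p n) (?q n)) \<and>
      operator_norm N \<le> \<omega> m"
    using acs unfolding acs_def B_def[symmetric] by blast
  \<comment> \<open>The threshold in \<open>n\<close> may depend on \<open>m\<close>, so a tolerance
    \<open>1 / (m + 1)\<close> that tends to 0 can be demanded at stage \<open>m\<close>.\<close>
  have "\<forall>m. \<exists>n1. \<forall>n\<in>I. n1 \<le> n \<longrightarrow> splits (?p n) (?q n) (upper_part s t (ns n) (\<lambda>k l. B m n $$ (k, l)))
      (1 / real (Suc m) * real (d n)) (1 / real (Suc m))"
  proof
    fix m
    have "vanishing \<nu> s t (\<lambda>ms. upper_part s t ms (\<lambda>k l.
        matrix_sum (sum_list ms * s) (sum_list ms * t)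
          (\<lambda>i. diagonal_sampling_matrix (sum_list ms) s s (\<lambda>x. a m i x \<cdot>\<^sub>m 1\<^sub>m s) *
            toeplitz_matrix (sum_list ms) s t (f m i)) {1..N m} $$ (k, l)))"
      by (rule vanishing_upper_sampling_toeplitz) (use assms(2) af in auto)
    from vanishingD[OF this, of "1 / real (Suc m)"] obtain m0 where
      m0: "\<And>ms. length ms = \<nu> \<Longrightarrow> m0 \<le> sum_list ms \<Longrightarrow>
        splits (sum_list ms * s) (sum_list ms * t) (upper_part s t ms (\<lambda>k l.
        matrix_sum (sum_list ms * s) (sum_list ms * t)
          (\<lambda>i. diagonal_sampling_matrix (sum_list ms) s s (\<lambda>x. a m i x \<cdot>\<^sub>m 1\<^sub>m s) *
            toeplitz_matrix (sum_list ms) s t (f m i)) {1..N m} $$ (k, l)))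
        (1 / real (Suc m) * real (sum_list ms)) (1 / real (Suc m))" by auto
    obtain n1 where n1: "\<forall>n\<in>I. n1 \<le> n \<longrightarrow> m0 \<le> d n" using to_infinity_alongD[OF assms(6)] by blast
    show "\<exists>n1. \<forall>n\<in>I. n1 \<le> n \<longrightarrow> splits (?p n) (?q n) (upper_part s t (ns n) (\<lambda>k l. B m n $$ (k, l)))
      (1 / real (Suc m) * real (d n)) (1 / real (Suc m))"
    proof (intro exI[of _ n1] ballI impI)
      fix n assume n: "n \<in> I" "n1 \<le> n"
      then have "m0 \<le> sum_list (ns n)" using n1 ns(2) by simp
      from m0[OF ns(1)[OF n(1)] this]
      show "splits (?p n) (?q n) (upper_part s t (ns n) (\<lambda>k l. B m n $$ (k, l)))
        (1 / real (Suc m) * real (d n)) (1 / real (Suc m))"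
        unfolding ns(2)[OF n(1)] B_def .
    qed
  qed
  then obtain n1 where upper: "\<And>m n. n \<in> I \<Longrightarrow> n1 m \<le> n \<Longrightarrow>
      splits (?p n) (?q n) (upper_part s t (ns n) (\<lambda>k l. B m n $$ (k, l)))
        (1 / real (Suc m) * real (d n)) (1 / real (Suc m))"
    unfolding choice_iff by blast
  have split': "\<exists>R\<in>carrier_mat (?p n) (?q n). \<exists>N\<in>carrier_mat (?p n) (?q n).
      blocktril s t (ns n) (A n) = B m n + R + N \<and>
      real (vec_space.rank (?p n) R) \<le> (real \<nu> * c m + 1 / real (Suc m)) * real (min (?p n) (?q n)) \<and>
      operator_norm N \<le> real \<nu> * \<omega> m + 1 / real (Suc m)"
    if n: "n \<in> I" "max (n0 m) (n1 m) \<le> n" for m n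
  proof -
    obtain R0 N0 where RN0: "R0 \<in> carrier_mat (?p n) (?q n)" "N0 \<in> carrier_mat (?p n) (?q n)"
      "A n = B m n + R0 + N0" "real (vec_space.rank (?p n) R0) \<le> c m * real (min (?p n) (?q n))"
      "operator_norm N0 \<le> \<omega> m"
      using split[of n m] n by auto
    have "n1 m \<le> n" using n(2) by simp
    from blocktril_perturbation[of "A n" "B m n" R0 N0 "ns n" s t, unfolded ns[OF n(1)],
        OF RN0(3) B RN0(1,2,4,5) upper[OF n(1) this]]
    obtain R' N' where RN: "R' \<in> carrier_mat (?p n) (?q n)" "N' \<in> carrier_mat (?p n) (?q n)"
      "blocktril s t (ns n) (A n) = B m n + R' + N'"
      "real (vec_space.rank (?p n) R') \<le> real \<nu> * (c m * real (min (?p n) (?q n))) + 1 / real (Suc m) * real (d n)"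
      "operator_norm N' \<le> real \<nu> * \<omega> m + 1 / real (Suc m)"
      by blast
    \<comment> \<open>The discarded part was measured against the number of blocks; as
      \<open>s\<close> and \<open>t\<close> are at least 1, this is at most the smaller dimension
      used in \<open>acs\<close>.\<close>
    have "d n \<le> min (?p n) (?q n)" using assms(2,3) by simp
    then have "1 / real (Suc m) * real (d n) \<le> 1 / real (Suc m) * real (min (?p n) (?q n))"
      by (intro mult_left_mono of_nat_mono) auto
    with RN(4) have "real (vec_space.rank (?p n) R')
        \<le> (real \<nu> * c m + 1 / real (Suc m)) * real (min (?p n) (?q n))"
      by (simp only: distrib_right mult.assoc)
    then show ?thesis using RN by blast
  qed
  have inv: "(\<lambda>m. 1 / real (Suc m)) \<longlonglongrightarrow> 0"
    using LIMSEQ_inverse_real_of_nat by (simp add: inverse_eq_divide)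
  have lims: "(\<lambda>m. real \<nu> * c m + 1 / real (Suc m)) \<longlonglongrightarrow> 0" "(\<lambda>m. real \<nu> * \<omega> m + 1 / real (Suc m)) \<longlonglongrightarrow> 0"
    using tendsto_add[OF tendsto_mult_left[OF c] inv] tendsto_add[OF tendsto_mult_left[OF \<omega>] inv] by simp_all
  have seq: "matrix_sequence I ?p ?q (\<lambda>n. blocktril s t (ns n) (A n))"
    using acs ns(2) unfolding acs_def matrix_sequence_def by (simp add: blocktril_def block_matrix_def)
  have "acs I ?p ?q B (\<lambda>n. blocktril s t (ns n) (A n))"
    unfolding acs_def
  proof (intro conjI)
    show "matrix_sequence I ?p ?q (\<lambda>n. blocktril s t (ns n) (A n))" by (rule seq)
    show "\<forall>m. matrix_sequence I ?p ?q (B m)" using acs unfolding acs_def B_def by blast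
    show "\<exists>n0 c \<omega>. c \<longlonglongrightarrow> 0 \<and> \<omega> \<longlonglongrightarrow> 0 \<and> (\<forall>m. \<forall>n\<in>I. n0 m \<le> n \<longrightarrow>
      (\<exists>R\<in>carrier_mat (?p n) (?q n). \<exists>N\<in>carrier_mat (?p n) (?q n).
        blocktril s t (ns n) (A n) = B m n + R + N \<and>
        real (vec_space.rank (?p n) R) \<le> c m * real (min (?p n) (?q n)) \<and> operator_norm N \<le> \<omega> m))"
      by (rule exI[of _ "\<lambda>m. max (n0 m) (n1 m)"], rule exI[of _ "\<lambda>m. real \<nu> * c m + 1 / real (Suc m)"],
          rule exI[of _ "\<lambda>m. real \<nu> * \<omega> m + 1 / real (Suc m)"])
        (intro conjI allI ballI impI lims split')
  qed
  \<comment> \<open>The approximants \<open>B\<close> are those given for \<open>A\<close>, so the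
    same \<open>N\<close>, \<open>a\<close> and \<open>f\<close> witness the symbol.\<close>
  then show ?thesis
    unfolding GLT_def B_def[abs_def]
    using assms(2,3,5,6,8) seq af lim by (intro conjI exI[of _ N] exI[of _ a] exI[of _ f]) auto
qed

end
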